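(* For any integer $\ell\ge2$ and any constant $0<c<\frac{1}{3\ell-2}$, we have, as $n\to\infty$, \[g(n;2\ell,cn)\ge\frac12\left(\frac{3\ell-5}{3\ell-2}+c-c^2-o(1)\right)n^2.\]
   Context: A red/blue/purple colouring of $K_n$ is a partition $R\cup B\cup P$ of its edge set. For integers $s,t\ge2$ and $n<R(s,t)$, $g(n;s,t)$ is the largest integer $g$ such that some red/blue/purple colouring of $K_n$ has $|P|=g$, $R\cup P$ is $K_s$-free and $B\cup P$ is $K_t$-free; for non-integer arguments $g(n;s,t):=g(n;\lceil s\rceil,\lceil t\rceil)$. *)

theory Defs
  imports "HOL-Analysis.Analysis" "HOL-Library.Ramsey" "HOL-Library.Landau_Symbols"
begin

text \<open>
  The vertex set of \<open>K\<^sub>n\<close> is \<open>{..<n}\<close> and its edge set is \<open>[{..<n}]\<^bsup>2\<^esup>\<close>, as in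
  \<^theory>\<open>HOL-Library.Ramsey\<close>.
\<close>

definition clique_free :: "nat \<Rightarrow> nat \<Rightarrow> nat set set \<Rightarrow> bool" where
  "clique_free n s E \<longleftrightarrow> \<not> (\<exists>K \<in> [{..<n}]\<^bsup>s\<^esup>. clique K E)"

definition ramsey_number :: "nat \<Rightarrow> nat \<Rightarrow> nat" where
  "ramsey_number s t = (LEAST N. partn_lst {..<N} [s, t] 2)"

text \<open>Colour classes are allowed to be empty.\<close>

definition rbp_colouring :: "nat \<Rightarrow> nat set set \<Rightarrow> nat set set \<Rightarrow> nat set set \<Rightarrow> bool" where
  "rbp_colouring n R B P \<longleftrightarrow>
     R \<union> B \<union> P = [{..<n}]\<^bsup>2\<^esup> \<and> R \<inter> B = {} \<and> R \<inter> P = {} \<and> B \<inter> P = {}"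

definition purple_sizes :: "nat \<Rightarrow> nat \<Rightarrow> nat \<Rightarrow> nat set" where
  "purple_sizes n s t =
     {card P | R B P. rbp_colouring n R B P \<and> clique_free n s (R \<union> P) \<and> clique_free n t (B \<union> P)}"

text \<open>
  \<open>g(n; s, t)\<close> is meaningful for \<open>s, t \<ge> 2\<close> and \<open>n < R(s, t)\<close>; by \<open>purple_sizes_nonempty_iff\<close>
  below the maximum is then taken over a nonempty finite set, and otherwise its value is unspecified.
\<close>

definition g_nat :: "nat \<Rightarrow> nat \<Rightarrow> nat \<Rightarrow> nat" where
  "g_nat n s t = Max (purple_sizes n s t)"

definition g :: "nat \<Rightarrow> real \<Rightarrow> real \<Rightarrow> nat" where
  "g n s t = g_nat n (nat \<lceil>s\<rceil>) (nat \<lceil>t\<rceil>)"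

lemma finite_purple_sizes: "finite (purple_sizes n s t)"
proof -
  have "purple_sizes n s t \<subseteq> card ` Pow ([{..<n}]\<^bsup>2\<^esup>)"
    unfolding purple_sizes_def rbp_colouring_def by blast
  then show ?thesis
    by (rule finite_subset) (simp add: finite_imp_finite_nsets)
qed

lemma less_ramsey_number_iff: "n < ramsey_number s t \<longleftrightarrow> \<not> partn_lst {..<n} [s, t] 2"
  unfolding ramsey_number_def
  by (metis (no_types, lifting) LeastI_ex Least_le linorder_not_less not_less_Least
      partn_lst_greater_resource ramsey_full)

lemma clique_iff_nsets: "clique K E \<longleftrightarrow> [K]\<^bsup>2\<^esup> \<subseteq> E"
  by (auto simp: clique_def nsets_2_eq)

lemma purple_sizes_nonempty_iff: "purple_sizes n s t \<noteq> {} \<longleftrightarrow> n < ramsey_number s t"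
proof
  assume "purple_sizes n s t \<noteq> {}"
  then obtain R B P where col: "rbp_colouring n R B P"
    and s: "clique_free n s (R \<union> P)" and t: "clique_free n t (B \<union> P)"
    unfolding purple_sizes_def by blast
  define f where "f e = (if e \<in> R \<union> P then 0 else 1 :: nat)" for e
  have "\<not> monochromatic {..<n} s 2 f 0"
    using s by (fastforce simp: monochromatic_def f_def clique_free_def clique_iff_nsets split: if_splits)
  moreover have "\<not> monochromatic {..<n} t 2 f 1"
  proof
    assume "monochromatic {..<n} t 2 f 1"
    then obtain H where H: "H \<in> [{..<n}]\<^bsup>t\<^esup>" "f ` [H]\<^bsup>2\<^esup> \<subseteq> {1}"
      unfolding monochromatic_def by blast
    have "[H]\<^bsup>2\<^esup> \<subseteq> [{..<n}]\<^bsup>2\<^esup>"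
      using H(1) by (intro nsets_mono) (auto simp: nsets_def)
    moreover have "e \<notin> R \<union> P" if "e \<in> [H]\<^bsup>2\<^esup>" for e
      using H(2) that by (auto simp: f_def split: if_splits)
    ultimately have "[H]\<^bsup>2\<^esup> \<subseteq> B \<union> P"
      using col unfolding rbp_colouring_def by blast
    with H(1) t show False
      by (auto simp: clique_free_def clique_iff_nsets)
  qed
  moreover have "f \<in> [{..<n}]\<^bsup>2\<^esup> \<rightarrow> {..<length [s, t]}"
    by (auto simp: f_def)
  ultimately show "n < ramsey_number s t"
    unfolding less_ramsey_number_iff partn_lst_def
    by (metis One_nat_def less_2_cases_iff length_Cons list.size(3) nth_Cons_0 nth_Cons_Suc
        numeral_2_eq_2)
next
  assume "n < ramsey_number s t"
  then obtain f where f: "f \<in> [{..<n}]\<^bsup>2\<^esup> \<rightarrow> {..<2::nat}"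
    and s: "\<not> monochromatic {..<n} s 2 f 0" and t: "\<not> monochromatic {..<n} t 2 f 1"
    unfolding less_ramsey_number_iff partn_lst_def
    by (auto simp: numeral_2_eq_2 All_less_Suc)
  define R where "R = {e \<in> [{..<n}]\<^bsup>2\<^esup>. f e = 0}"
  define B where "B = {e \<in> [{..<n}]\<^bsup>2\<^esup>. f e = 1}"
  have "rbp_colouring n R B {}"
    using f by (fastforce simp: rbp_colouring_def R_def B_def less_2_cases_iff)
  moreover have "clique_free n s (R \<union> {})"
    using s by (auto simp: clique_free_def clique_iff_nsets monochromatic_def R_def image_subset_iff subset_iff)
  moreover have "clique_free n t (B \<union> {})"
    using t by (auto simp: clique_free_def clique_iff_nsets monochromatic_def B_def image_subset_iff subset_iff)
  ultimately show "purple_sizes n s t \<noteq> {}"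
    unfolding purple_sizes_def by blast
qed

end

theory Submission
  imports Defs
begin

text \<open>
  Discretise the sphere of the Bollobas--Erdos graph by the row sums of \<open>h \<times> h\<close> sign matrices. A Poincare
  inequality on the cube shows that any two dense sets contain an almost antipodal pair, while a
  Littlewood--Offord bound shows that inner products are rarely small; hence almost half of all pairs have a
  noticeably positive inner product, and almost antipodal pairs are rare.

  Blow this up over \<open>l\<close> parts, two of size \<open>2 * m\<close> and \<open>l - 2\<close> of size \<open>3 * m\<close>, all almost antipodal edges being
  red and all other edges purple. The two small parts are joined by the positive inner product relation, except
  that in each of them \<open>q\<close> positions, with \<open>q / ((3 * l - 2) * m)\<close> close to \<open>c\<close>, carry no inner edges and are
  joined completely to the other part; together they have clique number 3. A large part carries a circular
  triangle-free purple graph of degree about \<open>q\<close>, and its red edges join positions without a common purple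
  neighbour, so that only arcs of length \<open>q\<close> are red-independent. All other pairs of parts are joined completely.
\<close>

section \<open>Poincare and Littlewood--Offord inequalities on the cube\<close>

text \<open>\<open>B \<union> P\<close> is \<open>K_t\<close>-free exactly when no \<open>t\<close>
  vertices are independent in the red graph alone, so a sparse red graph has to meet every set of
  about \<open>c * n\<close> vertices. The row sums of an \<open>h \<times> h\<close> sign matrix
  resemble a Gaussian vector in dimension \<open>h\<close> with standard deviation
  \<open>sqrt h\<close>. Two sets of fixed density are therefore at squared distance of order at
  most \<open>h\<close>, while inner products typically have order \<open>h * sqrt h\<close> and
  squared norms order \<open>h * h\<close>; these gaps separate almost antipodal pairs from ordinary
  ones. For plain sign vectors of length \<open>h\<close>, the squared distances between dense sets
  and the inner products would both have order \<open>sqrt h\<close>, leaving no gap. Since the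
  density is fixed while \<open>h\<close> is free, a variance bound suffices for the first scale and
  an anticoncentration bound for the other two. The condition \<open>c < 1 / (3 * l - 2)\<close>
  amounts to \<open>q < m\<close>: this is what keeps the circular purple graph on
  \<open>3 * m\<close> positions triangle-free.\<close>

definition bit_sign :: "'a \<Rightarrow> 'a set \<Rightarrow> real" where
  "bit_sign u x = (if u \<in> x then 1 else -1)"

definition flip :: "'a \<Rightarrow> 'a set \<Rightarrow> 'a set" where
  "flip u x = (if u \<in> x then x - {u} else insert u x)"

lemma flip_flip [simp]: "flip u (flip u x) = x"
  by (simp add: flip_def insert_absorb)

lemma flip_in_Pow: "u \<in> U \<Longrightarrow> x \<subseteq> U \<Longrightarrow> flip u x \<subseteq> U"
  by (auto simp: flip_def split: if_splits)

lemma bit_sign_flip: "bit_sign v (flip u x) = (if v = u then - bit_sign v x else bit_sign v x)"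
  by (cases "v = u"; cases "u \<in> x"; cases "v \<in> x") (simp_all add: flip_def bit_sign_def)

lemma bit_sign_cases: "bit_sign u x = 1 \<or> bit_sign u x = -1"
  by (auto simp: bit_sign_def)

lemma bit_sign_square [simp]: "bit_sign u x * bit_sign u x = 1"
  by (auto simp: bit_sign_def)

lemma bit_sign_Diff: "u \<in> U \<Longrightarrow> bit_sign u (U - x) = - bit_sign u x"
  by (auto simp: bit_sign_def)

lemma sum_flip: "u \<in> U \<Longrightarrow> (\<Sum>x\<in>Pow U. f (flip u x)) = (\<Sum>x\<in>Pow U. f x)"
  by (rule sum.reindex_bij_witness[where i="flip u" and j="flip u"]) (simp_all add: flip_in_Pow)

lemma sum_Pow_insert:
  assumes "finite U" "u \<notin> U"
  shows "(\<Sum>x\<in>Pow (insert u U). f x) = (\<Sum>x\<in>Pow U. f x) + (\<Sum>x\<in>Pow U. f (insert u x))"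
proof -
  have "inj_on (insert u) (Pow U)"
    using assms(2) by (auto simp: inj_on_def)
  moreover have "Pow U \<inter> insert u ` Pow U = {}"
    using assms(2) by auto
  ultimately show ?thesis
    using assms(1) by (simp add: Pow_insert sum.union_disjoint sum.reindex)
qed

text \<open>The left side is \<open>4 ^ card U\<close> times the variance of \<open>F\<close> on the
  uniform cube, and \<open>1 / 4\<close> is sharp for a single bit. A new coordinate splits the cube
  into two halves: the variance is the mean of the two variances plus a quarter of the squared
  difference of the means, and Cauchy-Schwarz charges the latter to the flips of the new
  coordinate.\<close>

lemma poincare_cube:
  fixes F :: "'a set \<Rightarrow> real"
  assumes "finite U"
  shows "2 ^ card U * (\<Sum>x\<in>Pow U. (F x)\<^sup>2) - (\<Sum>x\<in>Pow U. F x)\<^sup>2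
    \<le> 2 ^ card U / 4 * (\<Sum>x\<in>Pow U. \<Sum>u\<in>U. (F (flip u x) - F x)\<^sup>2)"
  using assms
proof (induction U arbitrary: F rule: finite_induct)
  case empty
  then show ?case by simp
next
  case (insert u U)
  define n :: real where "n = 2 ^ card U"
  define E where "E = (\<lambda>G :: 'a set \<Rightarrow> real. \<Sum>x\<in>Pow U. \<Sum>v\<in>U. (G (flip v x) - G x)\<^sup>2)"
  define G where "G x = F (insert u x)" for x
  have ih: "n * (\<Sum>x\<in>Pow U. (F x)\<^sup>2) - (\<Sum>x\<in>Pow U. F x)\<^sup>2 \<le> n / 4 * E F" for F
    unfolding n_def E_def by (rule insert.IH)
  have cs: "((\<Sum>x\<in>Pow U. F x) - (\<Sum>x\<in>Pow U. G x))\<^sup>2 \<le> n * (\<Sum>x\<in>Pow U. (G x - F x)\<^sup>2)"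
    using Cauchy_Schwarz_ineq_sum[of "\<lambda>_. 1" "\<lambda>x. F x - G x" "Pow U"] insert.hyps
    by (simp add: sum_subtractf card_Pow n_def power2_commute)
  have "flip v (insert u x) = insert u (flip v x)" if "v \<in> U" for v x
    using that insert.hyps by (auto simp: flip_def)
  then have 1: "(\<Sum>x\<in>Pow U. \<Sum>v\<in>U. (F (flip v (insert u x)) - F (insert u x))\<^sup>2) = E G"
    unfolding E_def G_def by (intro sum.cong) auto
  have 2: "(F (flip u x) - F x)\<^sup>2 = (G x - F x)\<^sup>2" "(F (flip u (insert u x)) - F (insert u x))\<^sup>2 = (G x - F x)\<^sup>2"
    if "x \<in> Pow U" for x
  proof -
    have "u \<notin> x" "insert u x - {u} = x"
      using that insert.hyps by auto
    then show "(F (flip u x) - F x)\<^sup>2 = (G x - F x)\<^sup>2"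
      "(F (flip u (insert u x)) - F (insert u x))\<^sup>2 = (G x - F x)\<^sup>2"
      by (auto simp: flip_def G_def power2_commute)
  qed
  have rhs: "(\<Sum>x\<in>Pow (insert u U). \<Sum>v\<in>insert u U. (F (flip v x) - F x)\<^sup>2)
     = E F + E G + 2 * (\<Sum>x\<in>Pow U. (G x - F x)\<^sup>2)"
  proof -
    have "(\<Sum>x\<in>Pow U. (F (flip u x) - F x)\<^sup>2) = (\<Sum>x\<in>Pow U. (G x - F x)\<^sup>2)"
      "(\<Sum>x\<in>Pow U. (F (flip u (insert u x)) - F (insert u x))\<^sup>2) = (\<Sum>x\<in>Pow U. (G x - F x)\<^sup>2)"
      by (intro sum.cong refl 2; simp)+
    then show ?thesis
      using insert.hyps 1 by (simp add: sum_Pow_insert sum.distrib E_def)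
  qed
  have c: "2 ^ card (insert u U) = 2 * n"
    using insert.hyps by (simp add: n_def)
  show ?case
    unfolding rhs c
    using ih[of F] ih[of G] cs insert.hyps
    by (simp add: sum_Pow_insert G_def[symmetric] algebra_simps power2_eq_square)
qed

section \<open>Anticoncentration of signed sums\<close>

lemma sum_bit_sign_mult:
  assumes "finite U" "u \<in> U" "v \<in> U" "u \<noteq> v"
  shows "(\<Sum>x\<in>Pow U. bit_sign u x * bit_sign v x) = 0"
proof -
  have "(\<Sum>x\<in>Pow U. bit_sign u x * bit_sign v x) = (\<Sum>x\<in>Pow U. bit_sign u (flip u x) * bit_sign v (flip u x))"
    by (rule sum_flip[symmetric]) fact
  also have "\<dots> = - (\<Sum>x\<in>Pow U. bit_sign u x * bit_sign v x)"
    using assms by (simp add: bit_sign_flip sum_negf)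
  finally show ?thesis by simp
qed

text \<open>The clamp level exceeds the window by \<open>2 * a\<close>, so a step of length
  \<open>2 * a\<close> that starts inside the window is not cut off; outside the window only
  monotonicity is used.\<close>

lemma clamp_step:
  fixes a c s y :: real
  assumes "a \<le> c" "a > 0" "s \<ge> 0"
  shows "(if \<bar>y\<bar> \<le> s then 2 * a else 0)
      \<le> max (- (s + 2 * a)) (min (s + 2 * a) y) - max (- (s + 2 * a)) (min (s + 2 * a) (y - 2 * c))"
    and "(if \<bar>y\<bar> \<le> s then 2 * a else 0)
      \<le> max (- (s + 2 * a)) (min (s + 2 * a) (y + 2 * c)) - max (- (s + 2 * a)) (min (s + 2 * a) y)"
  using assms by (simp_all add: max_def min_def abs_le_iff)

text \<open>
  The clamped sum \<open>\<phi>\<close> is monotone in each \<open>sgn (w u) * bit_sign u x\<close> and jumps by at least \<open>2 * a\<close> when a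
  coordinate in \<open>U'\<close> is flipped at a point of the window, so it correlates with the signed sum \<open>Z\<close>,
  whose second moment is \<open>card U'\<close>.
\<close>

lemma littlewood_offord:
  fixes w :: "'a \<Rightarrow> real"
  assumes U: "finite U" "U' \<subseteq> U" and w: "\<And>u. u \<in> U' \<Longrightarrow> a \<le> \<bar>w u\<bar>" and a: "a > 0" and s: "s \<ge> 0"
  shows "real (card {x \<in> Pow U. \<bar>(\<Sum>u\<in>U. w u * bit_sign u x) - v\<bar> \<le> s}) * a * sqrt (card U')
    \<le> (s + 2 * a) * 2 ^ card U"
proof (cases "U' = {}")
  case True
  then show ?thesis using a s by simp
next
  case False
  have fU': "finite U'" using U finite_subset by blast
  define S where "S x = (\<Sum>u\<in>U. w u * bit_sign u x) - v" for x
  define b where "b = s + 2 * a"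
  define \<phi> where "\<phi> x = max (-b) (min b (S x))" for x
  define F where "F = {x \<in> Pow U. \<bar>S x\<bar> \<le> s}"
  define Z where "Z x = (\<Sum>u\<in>U'. sgn (w u) * bit_sign u x)" for x
  have finF: "finite F" using U(1) by (simp add: F_def)
  have S_flip: "S (flip u x) = S x - 2 * (w u * bit_sign u x)" if "u \<in> U" for u x
  proof -
    have "(\<Sum>v\<in>U. w v * bit_sign v (flip u x)) =
        (\<Sum>v\<in>U. w v * bit_sign v x - (if v = u then 2 * (w u * bit_sign u x) else 0))"
      by (intro sum.cong) (auto simp: bit_sign_flip)
    also have "\<dots> = (\<Sum>v\<in>U. w v * bit_sign v x) - 2 * (w u * bit_sign u x)"
      using U(1) that by (simp add: sum_subtractf)
    finally show ?thesis by (simp add: S_def)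
  qed
  have one: "a * card F \<le> (\<Sum>x\<in>Pow U. \<phi> x * (sgn (w u) * bit_sign u x))" if u: "u \<in> U'" for u
  proof -
    have uU: "u \<in> U" using u U by auto
    have pt: "(if x \<in> F then 2 * a else 0) \<le> (\<phi> x - \<phi> (flip u x)) * (sgn (w u) * bit_sign u x)" if x: "x \<in> Pow U" for x
    proof -
      define t where "t = sgn (w u) * bit_sign u x"
      have "w u \<noteq> 0" using w[OF u] a by auto
      then have t: "t = 1 \<or> t = -1" and wt: "w u * bit_sign u x = \<bar>w u\<bar> * t"
        using bit_sign_cases[of u x] by (auto simp: t_def sgn_if)
      have fl: "S (flip u x) = S x - 2 * (\<bar>w u\<bar> * t)"
        using S_flip[OF uU, of x] wt by simp
      have F: "x \<in> F \<longleftrightarrow> \<bar>S x\<bar> \<le> s" if "x \<in> Pow U"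
        using that by (simp add: F_def)
      note cl = clamp_step[OF w[OF u] a s, of "S x"]
      have "(if \<bar>S x\<bar> \<le> s then 2 * a else 0) \<le> (\<phi> x - \<phi> (flip u x)) * t"
        using t
      proof
        assume t: "t = 1"
        show ?thesis
          using cl(1) unfolding t \<phi>_def b_def fl mult_1_right .
      next
        assume t: "t = -1"
        show ?thesis
          using cl(2) unfolding t \<phi>_def b_def fl by simp
      qed
      then show ?thesis using F[OF x] by (simp add: t_def)
    qed
    have "2 * a * card F = (\<Sum>x\<in>Pow U \<inter> F. 2 * a)"
    proof -
      have "Pow U \<inter> F = F" by (auto simp: F_def)
      then show ?thesis by simp
    qed
    also have "\<dots> = (\<Sum>x\<in>Pow U. if x \<in> F then 2 * a else 0)"
      using U(1) by (intro sum.inter_restrict) simp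
    also have "\<dots> \<le> (\<Sum>x\<in>Pow U. (\<phi> x - \<phi> (flip u x)) * (sgn (w u) * bit_sign u x))"
      by (intro sum_mono pt)
    also have "\<dots> = (\<Sum>x\<in>Pow U. \<phi> x * (sgn (w u) * bit_sign u x))
        - (\<Sum>x\<in>Pow U. \<phi> (flip u x) * (sgn (w u) * bit_sign u x))"
      by (simp add: left_diff_distrib sum_subtractf)
    \<comment> \<open>Flipping \<open>u\<close> reverses its sign, so this sum is minus the previous
      one; the doubled correlation absorbs the factor 2 in \<open>2 * a\<close>.\<close>
    also have "(\<Sum>x\<in>Pow U. \<phi> (flip u x) * (sgn (w u) * bit_sign u x))
        = (\<Sum>x\<in>Pow U. \<phi> (flip u (flip u x)) * (sgn (w u) * bit_sign u (flip u x)))"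
      by (rule sum_flip[symmetric]) fact
    also have "\<dots> = - (\<Sum>x\<in>Pow U. \<phi> x * (sgn (w u) * bit_sign u x))"
      by (simp add: bit_sign_flip sum_negf)
    finally show ?thesis by simp
  qed
  have Z2: "(\<Sum>x\<in>Pow U. (Z x)\<^sup>2) = 2 ^ card U * card U'"
  proof -
    have "(\<Sum>x\<in>Pow U. (Z x)\<^sup>2) = (\<Sum>x\<in>Pow U. \<Sum>u\<in>U'. \<Sum>u'\<in>U'. sgn (w u) * sgn (w u') * (bit_sign u x * bit_sign u' x))"
      by (simp add: Z_def power2_eq_square sum_product algebra_simps)
    also have "\<dots> = (\<Sum>u\<in>U'. \<Sum>u'\<in>U'. sgn (w u) * sgn (w u') * (\<Sum>x\<in>Pow U. bit_sign u x * bit_sign u' x))"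
      by (simp add: sum.swap[of _ _ "Pow U"] sum_distrib_left)
    also have "\<dots> = (\<Sum>u\<in>U'. \<Sum>u'\<in>U'. if u' = u then 2 ^ card U else 0)"
    proof (intro sum.cong refl)
      fix u u' assume uu: "u \<in> U'" "u' \<in> U'"
      show "sgn (w u) * sgn (w u') * (\<Sum>x\<in>Pow U. bit_sign u x * bit_sign u' x) = (if u' = u then 2 ^ card U else 0)"
      proof (cases "u' = u")
        case True
        then have "w u \<noteq> 0" using w[OF uu(1)] a by auto
        then show ?thesis using True U(1) by (simp add: card_Pow sgn_if)
      next
        case False
        then show ?thesis using uu U sum_bit_sign_mult[of U u u'] by auto
      qed
    qed
    also have "\<dots> = 2 ^ card U * card U'" using fU' by simp
    finally show ?thesis .
  qed
  have b: "b > 0" using a s by (simp add: b_def)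
  have "card U' * (a * card F) = (\<Sum>u\<in>U'. a * card F)" by simp
  also have "\<dots> \<le> (\<Sum>u\<in>U'. \<Sum>x\<in>Pow U. \<phi> x * (sgn (w u) * bit_sign u x))"
    by (intro sum_mono one)
  also have "\<dots> = (\<Sum>x\<in>Pow U. \<phi> x * Z x)"
    by (subst sum.swap) (simp add: Z_def sum_distrib_left)
  also have "\<dots> \<le> (\<Sum>x\<in>Pow U. b * \<bar>Z x\<bar>)"
  proof (intro sum_mono)
    fix x
    have "\<bar>\<phi> x\<bar> \<le> b" using b by (auto simp: \<phi>_def)
    then have "\<bar>\<phi> x * Z x\<bar> \<le> b * \<bar>Z x\<bar>" by (simp add: abs_mult mult_right_mono)
    then show "\<phi> x * Z x \<le> b * \<bar>Z x\<bar>" by linarith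
  qed
  also have "\<dots> = b * (\<Sum>x\<in>Pow U. \<bar>Z x\<bar>)" by (simp add: sum_distrib_left)
  also have "(\<Sum>x\<in>Pow U. \<bar>Z x\<bar>) \<le> 2 ^ card U * sqrt (card U')"
  proof (rule power2_le_imp_le)
    show "(\<Sum>x\<in>Pow U. \<bar>Z x\<bar>)\<^sup>2 \<le> (2 ^ card U * sqrt (card U'))\<^sup>2"
      using Cauchy_Schwarz_ineq_sum[of "\<lambda>_. 1" "\<lambda>x. \<bar>Z x\<bar>" "Pow U"] U(1) Z2
      by (simp add: card_Pow power_mult_distrib power2_eq_square[of "2 ^ _"] mult.assoc)
  qed simp
  finally have *: "card U' * (a * card F) \<le> b * (2 ^ card U * sqrt (card U'))"
    using b by simp
  have q: "sqrt (card U') > 0" using False fU' by (simp add: card_gt_0_iff)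
  have "sqrt (card U') * (card F * a * sqrt (card U')) \<le> sqrt (card U') * (b * 2 ^ card U)"
    using * by (simp add: algebra_simps)
  then have "card F * a * sqrt (card U') \<le> b * 2 ^ card U"
    using q by simp
  then show ?thesis by (simp add: F_def S_def b_def)
qed

section \<open>Sign matrices and their row sums\<close>

definition row_sum :: "nat \<Rightarrow> nat \<Rightarrow> (nat \<times> nat) set \<Rightarrow> real" where
  "row_sum h i x = (\<Sum>j<h. bit_sign (i, j) x)"

definition norm_sq :: "nat \<Rightarrow> (nat \<Rightarrow> real) \<Rightarrow> real" where
  "norm_sq h v = (\<Sum>i<h. (v i)\<^sup>2)"

abbreviation grid :: "nat \<Rightarrow> (nat \<times> nat) set" where
  "grid h \<equiv> {..<h} \<times> {..<h}"

lemma row_sum_flip: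
  assumes "a \<in> {..<h}" "b \<in> {..<h}"
  shows "row_sum h i (flip (a, b) x) = row_sum h i x - (if i = a then 2 * bit_sign (a, b) x else 0)"
proof -
  have "row_sum h i (flip (a, b) x)
      = (\<Sum>j<h. bit_sign (i, j) x - (if j = b then (if i = a then 2 * bit_sign (a, b) x else 0) else 0))"
    unfolding row_sum_def by (intro sum.cong refl) (simp add: bit_sign_flip)
  also have "\<dots> = row_sum h i x - (if i = a then 2 * bit_sign (a, b) x else 0)"
    using assms by (simp add: sum_subtractf row_sum_def)
  finally show ?thesis .
qed

lemma row_sum_Diff: "i < h \<Longrightarrow> row_sum h i (grid h - x) = - row_sum h i x"
  unfolding row_sum_def by (simp add: bit_sign_Diff sum_negf)

lemma norm_sq_nonneg: "norm_sq h v \<ge> 0"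
  by (simp add: norm_sq_def sum_nonneg)

lemma norm_sq_row_sum_flip:
  assumes "a \<in> {..<h}" "b \<in> {..<h}"
  shows "norm_sq h (\<lambda>i. row_sum h i (flip (a, b) x) - v i)
    \<le> norm_sq h (\<lambda>i. row_sum h i x - v i) + (4 * \<bar>row_sum h a x - v a\<bar> + 4)"
proof -
  define d where "d i = row_sum h i x - v i" for i
  define s where "s = bit_sign (a, b) x"
  have s: "s = 1 \<or> s = -1" using bit_sign_cases s_def by metis
  have "norm_sq h (\<lambda>i. row_sum h i (flip (a, b) x) - v i)
      = (\<Sum>i<h. (d i)\<^sup>2 + (if i = a then 4 - 4 * s * d a else 0))"
    unfolding norm_sq_def row_sum_flip[OF assms] s_def[symmetric]
    using s by (intro sum.cong refl) (auto simp: d_def power2_eq_square algebra_simps)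
  also have "\<dots> = norm_sq h d + (4 - 4 * s * d a)"
    using assms by (simp add: sum.distrib norm_sq_def)
  also have "\<dots> \<le> norm_sq h d + (4 * \<bar>d a\<bar> + 4)"
    using s by auto
  finally show ?thesis by (simp add: d_def[abs_def])
qed

text \<open>
  A distance function in Euclidean norm changes by too much under single bit flips to have a good
  discrete gradient near \<open>A\<close>; the square root of \<open>dist\<^sup>2 + h\<close> smooths it at the scale \<open>sqrt h\<close>, and the
  sum of its squared increasing differences is at most \<open>32 * h\<close> at every point.
\<close>

lemma dense_sets_close:
  assumes h: "h > 0" and \<epsilon>: "\<epsilon> > 0"
    and A: "A \<subseteq> Pow (grid h)" "real (card A) \<ge> \<epsilon> * 2 ^ (h * h)"
    and B: "B \<subseteq> Pow (grid h)" "real (card B) \<ge> \<epsilon> * 2 ^ (h * h)"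
  shows "\<exists>x\<in>A. \<exists>y\<in>B. norm_sq h (\<lambda>i. row_sum h i y - row_sum h i x) \<le> (1 + 6 / \<epsilon>)\<^sup>2 * h"
proof (rule ccontr)
  assume contra: "\<not> ?thesis"
  define n :: real where "n = 2 ^ (h * h)"
  define U where "U = grid h"
  have U: "finite U" "card U = h * h" by (simp_all add: U_def)
  have n: "n > 0" "2 ^ card U = n" by (simp_all add: n_def U)
  have fin: "finite A" "finite B"
    using finite_subset[OF A(1)] finite_subset[OF B(1)] by simp_all
  have An: "card A \<ge> \<epsilon> * n" "card B \<ge> \<epsilon> * n" using A(2) B(2) unfolding n_def by simp_all
  have "\<epsilon> * n > 0" using \<epsilon> n(1) by simp
  then have "card A > 0" using An(1) by linarith
  then have "A \<noteq> {}" by auto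
  define dd where "dd x a = norm_sq h (\<lambda>i. row_sum h i x - row_sum h i a)" for x a
  define D where "D x = Min (dd x ` A)" for x
  define F where "F x = sqrt (D x + h)" for x
  have D_le: "D x \<le> dd x a" if "a \<in> A" for x a
    using that fin by (simp add: D_def)
  have D_ex: "\<exists>a\<in>A. D x = dd x a" for x
  proof -
    have "D x \<in> dd x ` A" unfolding D_def using fin \<open>A \<noteq> {}\<close> by (intro Min_in) auto
    then show ?thesis by auto
  qed
  have D_nn: "D x \<ge> 0" for x using D_ex[of x] by (auto simp: dd_def norm_sq_nonneg)
  have F2: "(F x)\<^sup>2 = D x + h" for x using D_nn[of x] by (simp add: F_def)
  have F_pos: "F x > 0" for x using D_nn[of x] h by (simp add: F_def add_nonneg_pos)
  \<comment> \<open>Only increases are controlled: a nearest point \<open>a\<close> of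
    \<open>x\<close> bounds \<open>D\<close> at the neighbours of \<open>x\<close> from above, not
    from below.\<close>
  define ps where "ps t = (max t 0)\<^sup>2" for t :: real
  have step: "(\<Sum>u\<in>U. ps (F (flip u x) - F x)) \<le> 32 * real h" for x
  proof -
    obtain a where a: "a \<in> A" "D x = dd x a" using D_ex by blast
    define d where "d i = row_sum h i x - row_sum h i a" for i
    have dd: "dd x a = norm_sq h d" by (simp add: dd_def d_def[abs_def])
    have one: "ps (F (flip (i, j) x) - F x) \<le> (32 * (d i)\<^sup>2 + 32) / (D x + h)" if "i < h" "j < h" for i j
    proof -
      have "D (flip (i, j) x) \<le> D x + (4 * \<bar>d i\<bar> + 4)"
        using D_le[OF a(1), of "flip (i, j) x"] norm_sq_row_sum_flip[of i h j x "\<lambda>i. row_sum h i a"] that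
        unfolding a(2) by (simp add: dd_def d_def)
      then have *: "(F (flip (i, j) x))\<^sup>2 \<le> (F x)\<^sup>2 + (4 * \<bar>d i\<bar> + 4)" by (simp add: F2)
      have "F (flip (i, j) x) - F x \<le> (4 * \<bar>d i\<bar> + 4) / F x"
      proof -
        have "((F x) + (4 * \<bar>d i\<bar> + 4) / F x)\<^sup>2 \<ge> (F x)\<^sup>2 + 2 * (4 * \<bar>d i\<bar> + 4)"
          using F_pos[of x] by (simp add: power2_sum)
        moreover have "(F (flip (i, j) x))\<^sup>2 \<le> (F x)\<^sup>2 + 2 * (4 * \<bar>d i\<bar> + 4)"
          using * by (smt (verit) abs_ge_zero)
        ultimately have "(F (flip (i, j) x))\<^sup>2 \<le> ((F x) + (4 * \<bar>d i\<bar> + 4) / F x)\<^sup>2"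
          by (rule order_trans[rotated])
        moreover have "0 \<le> F x + (4 * \<bar>d i\<bar> + 4) / F x" using F_pos[of x] by simp
        ultimately have "F (flip (i, j) x) \<le> F x + (4 * \<bar>d i\<bar> + 4) / F x" by (rule power2_le_imp_le)
        then show ?thesis by simp
      qed
      then have "ps (F (flip (i, j) x) - F x) \<le> ((4 * \<bar>d i\<bar> + 4) / F x)\<^sup>2"
        unfolding ps_def using F_pos[of x] by (intro power_mono) auto
      also have "\<dots> = (4 * \<bar>d i\<bar> + 4)\<^sup>2 / (D x + h)" by (simp add: power_divide F2)
      also have "\<dots> \<le> (32 * (d i)\<^sup>2 + 32) / (D x + h)"
      proof (rule divide_right_mono)
        have "0 \<le> (4 * \<bar>d i\<bar> - 4)\<^sup>2" by simp
        then show "(4 * \<bar>d i\<bar> + 4)\<^sup>2 \<le> 32 * (d i)\<^sup>2 + 32"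
          by (simp add: power2_eq_square algebra_simps)
      qed (use D_nn[of x] in simp)
      finally show ?thesis .
    qed
    have "(\<Sum>u\<in>U. ps (F (flip u x) - F x)) = (\<Sum>i<h. \<Sum>j<h. ps (F (flip (i, j) x) - F x))"
      by (simp add: U_def sum.cartesian_product)
    also have "\<dots> \<le> (\<Sum>i<h. \<Sum>j<h. (32 * (d i)\<^sup>2 + 32) / (D x + h))"
      by (intro sum_mono one) auto
    also have "\<dots> = (\<Sum>i<h. (32 * (d i)\<^sup>2 + 32) * (h / (D x + h)))"
      by (simp add: mult.commute)
    also have "\<dots> = (\<Sum>i<h. 32 * (d i)\<^sup>2 + 32) * (h / (D x + h))"
      by (simp only: sum_distrib_right)
    also have "(\<Sum>i<h. 32 * (d i)\<^sup>2 + 32) = 32 * (norm_sq h d + h)"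
      by (simp add: norm_sq_def sum.distrib sum_distrib_left)
    \<comment> \<open>The offset \<open>h\<close> inside the square root makes numerator and
      denominator cancel exactly, however close \<open>x\<close> is to \<open>A\<close>.\<close>
    also have "32 * (norm_sq h d + h) * (h / (D x + h)) = 32 * real h"
    proof -
      have "norm_sq h d + h > 0" using norm_sq_nonneg[of h d] h by simp
      then show ?thesis unfolding a(2) dd by (simp add: field_simps)
    qed
    finally show ?thesis .
  qed
  \<comment> \<open>A change along an edge of the cube is an increase from one of its two ends, so
    the full energy is twice the energy of the increases.\<close>
  have split: "(t::real)\<^sup>2 = ps t + ps (- t)" for t
    by (auto simp: ps_def max_def)
  have "(\<Sum>x\<in>Pow U. \<Sum>u\<in>U. (F (flip u x) - F x)\<^sup>2)
      = (\<Sum>u\<in>U. (\<Sum>x\<in>Pow U. ps (F (flip u x) - F x)) + (\<Sum>x\<in>Pow U. ps (F x - F (flip u x))))"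
    by (subst sum.swap) (simp add: split sum.distrib)
  also have "\<dots> = (\<Sum>u\<in>U. (\<Sum>x\<in>Pow U. ps (F (flip u x) - F x)) + (\<Sum>x\<in>Pow U. ps (F (flip u x) - F x)))"
  proof (intro sum.cong refl)
    fix u assume u: "u \<in> U"
    show "(\<Sum>x\<in>Pow U. ps (F (flip u x) - F x)) + (\<Sum>x\<in>Pow U. ps (F x - F (flip u x)))
      = (\<Sum>x\<in>Pow U. ps (F (flip u x) - F x)) + (\<Sum>x\<in>Pow U. ps (F (flip u x) - F x))"
      using sum_flip[OF u, of "\<lambda>x. ps (F x - F (flip u x))"] by simp
  qed
  also have "\<dots> = 2 * (\<Sum>u\<in>U. \<Sum>x\<in>Pow U. ps (F (flip u x) - F x))"
    by (simp add: sum.distrib sum_distrib_left)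
  also have "\<dots> = 2 * (\<Sum>x\<in>Pow U. \<Sum>u\<in>U. ps (F (flip u x) - F x))"
    by (subst sum.swap) (rule refl)
  also have "\<dots> \<le> 2 * (\<Sum>x\<in>Pow U. 32 * real h)"
    by (intro mult_left_mono sum_mono step) simp_all
  also have "\<dots> = 64 * h * n" using U by (simp add: card_Pow n_def)
  finally have energy: "(\<Sum>x\<in>Pow U. \<Sum>u\<in>U. (F (flip u x) - F x)\<^sup>2) \<le> 64 * h * n" .
  have "n * (\<Sum>x\<in>Pow U. (F x)\<^sup>2) - (\<Sum>x\<in>Pow U. F x)\<^sup>2 \<le> n / 4 * (64 * h * n)"
    using poincare_cube[OF U(1), of F] energy n
    by (smt (verit) divide_nonneg_nonneg mult_left_mono)
  then have var: "n * (\<Sum>x\<in>Pow U. (F x)\<^sup>2) - (\<Sum>x\<in>Pow U. F x)\<^sup>2 \<le> 16 * h * n\<^sup>2"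
    by (simp add: power2_eq_square algebra_simps)
  have dbl: "(\<Sum>x\<in>Pow U. \<Sum>y\<in>Pow U. (F x - F y)\<^sup>2) = 2 * (n * (\<Sum>x\<in>Pow U. (F x)\<^sup>2) - (\<Sum>x\<in>Pow U. F x)\<^sup>2)"
  proof -
    have "(\<Sum>x\<in>Pow U. \<Sum>y\<in>Pow U. (F x - F y)\<^sup>2)
        = (\<Sum>x\<in>Pow U. \<Sum>y\<in>Pow U. (F x)\<^sup>2) + (\<Sum>x\<in>Pow U. \<Sum>y\<in>Pow U. (F y)\<^sup>2) - 2 * (\<Sum>x\<in>Pow U. \<Sum>y\<in>Pow U. F x * F y)"
      by (simp add: power2_diff sum.distrib sum_subtractf sum_distrib_left mult.assoc)
    also have "(\<Sum>x\<in>Pow U. \<Sum>y\<in>Pow U. F x * F y) = (\<Sum>x\<in>Pow U. F x)\<^sup>2"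
      by (simp add: power2_eq_square sum_product)
    finally show ?thesis using U by (simp add: card_Pow n_def sum_distrib_left)
  qed
  \<comment> \<open>If the claim fails, \<open>F\<close> equals \<open>sqrt h\<close> on
    \<open>A\<close> and is at least \<open>(1 + 6 / \<epsilon>) * sqrt h\<close> on
    \<open>B\<close>. The 6 is chosen because \<open>6 * 6 = 36\<close> exceeds the 32 obtained from
    doubling the variance bound.\<close>
  have far: "(6 / \<epsilon>)\<^sup>2 * h \<le> (F x - F y)\<^sup>2" if "x \<in> A" "y \<in> B" for x y
  proof -
    have "dd x x = 0" by (simp add: dd_def norm_sq_def)
    then have "D x = 0" using D_le[OF that(1), of x] D_nn[of x] by simp
    then have Fx: "F x = sqrt h" by (simp add: F_def)
    obtain a where a: "a \<in> A" "D y = dd y a" using D_ex by blast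
    then have "D y \<ge> (1 + 6 / \<epsilon>)\<^sup>2 * h" using contra that by (force simp: dd_def)
    then have "F y \<ge> sqrt ((1 + 6 / \<epsilon>)\<^sup>2 * h)" by (simp add: F_def)
    then have "F y \<ge> (1 + 6 / \<epsilon>) * sqrt h" using \<epsilon> by (simp add: real_sqrt_mult)
    then have "F y - F x \<ge> 6 / \<epsilon> * sqrt h" using Fx by (simp add: algebra_simps)
    then have "(F y - F x)\<^sup>2 \<ge> (6 / \<epsilon> * sqrt h)\<^sup>2" using \<epsilon> by (intro power_mono) auto
    then show ?thesis by (simp add: power_mult_distrib power_divide power2_commute)
  qed
  have "card A * (card B * ((6 / \<epsilon>)\<^sup>2 * h)) = (\<Sum>x\<in>A. \<Sum>y\<in>B. (6 / \<epsilon>)\<^sup>2 * h)" by simp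
  also have "\<dots> \<le> (\<Sum>x\<in>A. \<Sum>y\<in>B. (F x - F y)\<^sup>2)" by (intro sum_mono far)
  also have "\<dots> \<le> (\<Sum>x\<in>A. \<Sum>y\<in>Pow U. (F x - F y)\<^sup>2)"
    using B U by (intro sum_mono sum_mono2) (auto simp: U_def)
  also have "\<dots> \<le> (\<Sum>x\<in>Pow U. \<Sum>y\<in>Pow U. (F x - F y)\<^sup>2)"
    using A U by (intro sum_mono2) (auto simp: U_def intro!: sum_nonneg)
  also have "\<dots> \<le> 32 * h * n\<^sup>2" using dbl var by simp
  finally have le: "card A * (card B * ((6 / \<epsilon>)\<^sup>2 * h)) \<le> 32 * h * n\<^sup>2" .
  have "(\<epsilon> * n) * ((\<epsilon> * n) * ((6 / \<epsilon>)\<^sup>2 * h)) \<le> card A * (card B * ((6 / \<epsilon>)\<^sup>2 * h))"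
    using An \<epsilon> n by (intro mult_mono mult_right_mono) auto
  also have "(\<epsilon> * n) * ((\<epsilon> * n) * ((6 / \<epsilon>)\<^sup>2 * h)) = 36 * h * n\<^sup>2"
    using \<epsilon> by (simp add: power2_eq_square field_simps)
  finally have ge: "36 * h * n\<^sup>2 \<le> card A * (card B * ((6 / \<epsilon>)\<^sup>2 * h))" .
  have "0 < h * n\<^sup>2" using h n by simp
  then show False using le ge by linarith
qed

text \<open>A row sum is a sum of \<open>h\<close> independent signs, so it lies in a given window
  of radius \<open>K\<close> with probability at most \<open>(K + 2) / sqrt h\<close>. Markov's
  inequality for the number of such rows, at threshold \<open>h / 2\<close>, doubles this.\<close>

lemma few_small_rows:
  assumes h: "h > 0" and K: "K \<ge> 0"
  shows "real (card {x \<in> Pow (grid h). h < 2 * card {i \<in> {..<h}. \<bar>row_sum h i x - v i\<bar> \<le> K}})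
    \<le> 2 * (K + 2) / sqrt h * 2 ^ (h * h)"
proof -
  define n :: real where "n = 2 ^ (h * h)"
  define c where "c x = card {i \<in> {..<h}. \<bar>row_sum h i x - v i\<bar> \<le> K}" for x
  define S where "S = {x \<in> Pow (grid h). h < 2 * c x}"
  have sq: "sqrt h > 0" using h by simp
  have row: "real (card {x \<in> Pow (grid h). \<bar>row_sum h i x - v i\<bar> \<le> K}) \<le> (K + 2) / sqrt h * n" if i: "i < h" for i
  proof -
    define w :: "nat \<times> nat \<Rightarrow> real" where "w = (\<lambda>u. if fst u = i then 1 else 0)"
    have "(\<Sum>u\<in>grid h. w u * bit_sign u x) = row_sum h i x" for x
    proof -
      have "(\<Sum>u\<in>grid h. w u * bit_sign u x) = (\<Sum>i'<h. \<Sum>j<h. w (i', j) * bit_sign (i', j) x)"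
        by (simp add: sum.cartesian_product)
      also have "\<dots> = (\<Sum>i'<h. if i' = i then row_sum h i x else 0)"
        by (intro sum.cong refl) (simp add: w_def row_sum_def)
      also have "\<dots> = row_sum h i x" using i by simp
      finally show ?thesis .
    qed
    moreover have "{i} \<times> {..<h} \<subseteq> grid h" using i by auto
    ultimately have "real (card {x \<in> Pow (grid h). \<bar>row_sum h i x - v i\<bar> \<le> K}) * 1 * sqrt (card ({i} \<times> {..<h}))
      \<le> (K + 2 * 1) * 2 ^ card (grid h)"
      using littlewood_offord[of "grid h" "{i} \<times> {..<h}" 1 w K "v i"] i K by (auto simp: w_def)
    then show ?thesis using sq by (simp add: n_def field_simps card_cartesian_product)
  qed
  have "card S * (h / 2) = (\<Sum>x\<in>S. real h / 2)" by simp
  also have "\<dots> \<le> (\<Sum>x\<in>S. real (c x))" by (intro sum_mono) (auto simp: S_def)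
  also have "\<dots> \<le> (\<Sum>x\<in>Pow (grid h). real (c x))" by (intro sum_mono2) (auto simp: S_def)
  also have "\<dots> = (\<Sum>x\<in>Pow (grid h). \<Sum>i<h. if \<bar>row_sum h i x - v i\<bar> \<le> K then 1 else 0)"
    by (simp add: c_def sum.inter_filter[symmetric])
  also have "\<dots> = (\<Sum>i<h. \<Sum>x\<in>Pow (grid h). if \<bar>row_sum h i x - v i\<bar> \<le> K then 1 else 0)"
    by (rule sum.swap)
  also have "\<dots> = (\<Sum>i<h. real (card {x \<in> Pow (grid h). \<bar>row_sum h i x - v i\<bar> \<le> K}))"
    by (simp add: sum.inter_filter[symmetric] del: Pow_iff)
  also have "\<dots> \<le> (\<Sum>i<h. (K + 2) / sqrt h * n)" by (intro sum_mono row) simp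
  also have "\<dots> = 2 * ((K + 2) / sqrt h * n) * (h / 2)" by simp
  also have "2 * ((K + 2) / sqrt h * n) = 2 * (K + 2) / sqrt h * n" by simp
  finally have "card S \<le> 2 * (K + 2) / sqrt h * n"
    by (rule mult_right_le_imp_le) (use h in simp)
  then show ?thesis by (simp add: S_def c_def n_def)
qed

lemma norm_sq_ge_of_large_rows:
  assumes "2 * card {i \<in> {..<h}. \<bar>d i\<bar> \<le> K} \<le> h" "K \<ge> 0"
  shows "K\<^sup>2 * h / 2 \<le> norm_sq h d"
proof -
  define S where "S = {i \<in> {..<h}. \<bar>d i\<bar> \<le> K}"
  have S: "S \<subseteq> {..<h}" "finite S" by (auto simp: S_def)
  have "card ({..<h} - S) = h - card S" using S by (simp add: card_Diff_subset)
  then have "real h / 2 \<le> card ({..<h} - S)" using assms(1) by (simp add: S_def)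
  then have "K\<^sup>2 * (h / 2) \<le> K\<^sup>2 * card ({..<h} - S)" by (intro mult_left_mono) auto
  also have "\<dots> = (\<Sum>i\<in>{..<h} - S. K\<^sup>2)" by simp
  also have "\<dots> \<le> (\<Sum>i\<in>{..<h} - S. (d i)\<^sup>2)"
  proof (intro sum_mono)
    fix i assume "i \<in> {..<h} - S"
    then have "K \<le> \<bar>d i\<bar>" by (auto simp: S_def)
    then show "K\<^sup>2 \<le> (d i)\<^sup>2" using assms(2) power_mono[of K "\<bar>d i\<bar>" 2] by simp
  qed
  also have "\<dots> \<le> norm_sq h d" unfolding norm_sq_def by (intro sum_mono2) auto
  finally show ?thesis by simp
qed

text \<open>A ball of squared radius \<open>s * h\<close> forces more than half of the rows to be
  within \<open>K\<close> of \<open>v\<close>. With \<open>v\<close> zero, a row sum vector or its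
  negative, this shows that short vectors, close pairs and almost antipodal pairs are rare.\<close>

lemma few_near_vector:
  assumes h: "h > 0" and K: "K \<ge> 0" and s: "s < K\<^sup>2 / 2"
  shows "real (card {x \<in> Pow (grid h). norm_sq h (\<lambda>i. row_sum h i x - v i) \<le> s * h})
    \<le> 2 * (K + 2) / sqrt h * 2 ^ (h * h)"
proof -
  have *: "s * h < K\<^sup>2 * h / 2" using h s mult_strict_right_mono[of s "K\<^sup>2 / 2" "real h"] by simp
  have "{x \<in> Pow (grid h). norm_sq h (\<lambda>i. row_sum h i x - v i) \<le> s * h}
    \<subseteq> {x \<in> Pow (grid h). h < 2 * card {i \<in> {..<h}. \<bar>row_sum h i x - v i\<bar> \<le> K}}"
  proof (intro subsetI CollectI conjI)
    fix x assume x: "x \<in> {x \<in> Pow (grid h). norm_sq h (\<lambda>i. row_sum h i x - v i) \<le> s * h}"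
    then show "x \<in> Pow (grid h)" by blast
    show "h < 2 * card {i \<in> {..<h}. \<bar>row_sum h i x - v i\<bar> \<le> K}"
    proof (rule ccontr)
      assume "\<not> ?thesis"
      then have "K\<^sup>2 * h / 2 \<le> norm_sq h (\<lambda>i. row_sum h i x - v i)"
        using norm_sq_ge_of_large_rows[of h "\<lambda>i. row_sum h i x - v i" K] K by simp
      with * x show False by simp
    qed
  qed
  then have "card {x \<in> Pow (grid h). norm_sq h (\<lambda>i. row_sum h i x - v i) \<le> s * h}
    \<le> card {x \<in> Pow (grid h). h < 2 * card {i \<in> {..<h}. \<bar>row_sum h i x - v i\<bar> \<le> K}}"
    by (intro card_mono) auto
  then show ?thesis using few_small_rows[OF h K, of v] by linarith
qed

section \<open>Inner products of row sum vectors\<close>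

definition row_inner :: "nat \<Rightarrow> (nat \<times> nat) set \<Rightarrow> (nat \<times> nat) set \<Rightarrow> real" where
  "row_inner h x y = (\<Sum>i<h. row_sum h i x * row_sum h i y)"

text \<open>For fixed \<open>y\<close> the inner product is a signed sum over all
  \<open>h * h\<close> bits of \<open>x\<close>, where the bit \<open>(i, j)\<close> has the
  \<open>i\<close>-th row sum of \<open>y\<close> as its weight. At least half of these weights
  exceed \<open>K\<close> in absolute value, so Littlewood-Offord gains a factor of order
  \<open>h\<close>.\<close>

lemma few_small_inner:
  assumes h: "h > 0" and K: "K > 0" and s: "s \<ge> 0"
    and y: "2 * card {i \<in> {..<h}. \<bar>row_sum h i y\<bar> \<le> K} \<le> h"
  shows "real (card {x \<in> Pow (grid h). \<bar>row_inner h x y\<bar> \<le> s}) \<le> 2 * (s + 2 * K) / (K * h) * 2 ^ (h * h)"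
proof -
  define S where "S = {i \<in> {..<h}. \<bar>row_sum h i y\<bar> > K}"
  have "card S = h - card {i \<in> {..<h}. \<bar>row_sum h i y\<bar> \<le> K}"
  proof -
    have "S = {..<h} - {i \<in> {..<h}. \<bar>row_sum h i y\<bar> \<le> K}" by (auto simp: S_def)
    then show ?thesis
      using card_Diff_subset[of "{i \<in> {..<h}. \<bar>row_sum h i y\<bar> \<le> K}" "{..<h}"] by auto
  qed
  then have S: "real h / 2 \<le> card S" using y by linarith
  have "(h / 2)\<^sup>2 \<le> card (S \<times> {..<h})"
  proof -
    have "(real h / 2)\<^sup>2 \<le> real h / 2 * h" by (simp add: power2_eq_square)
    also have "\<dots> \<le> real (card S) * real h" using S by (intro mult_right_mono) auto
    finally show ?thesis by (simp add: card_cartesian_product)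
  qed
  then have sq: "h / 2 \<le> sqrt (card (S \<times> {..<h}))" by (rule real_le_rsqrt)
  define w where "w = (\<lambda>u :: nat \<times> nat. row_sum h (fst u) y)"
  have "(\<Sum>u\<in>grid h. w u * bit_sign u x) = row_inner h x y" for x
  proof -
    have "(\<Sum>u\<in>grid h. w u * bit_sign u x) = (\<Sum>i<h. \<Sum>j<h. w (i, j) * bit_sign (i, j) x)"
      by (simp add: sum.cartesian_product)
    also have "\<dots> = row_inner h x y"
      unfolding row_inner_def
      by (intro sum.cong refl) (simp add: w_def row_sum_def[of h _ x] sum_distrib_left mult.commute)
    finally show ?thesis .
  qed
  moreover have "S \<times> {..<h} \<subseteq> grid h" by (auto simp: S_def)
  ultimately have "real (card {x \<in> Pow (grid h). \<bar>row_inner h x y\<bar> \<le> s}) * K * sqrt (card (S \<times> {..<h}))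
      \<le> (s + 2 * K) * 2 ^ card (grid h)"
    using littlewood_offord[of "grid h" "S \<times> {..<h}" K w s 0] K s by (auto simp: w_def S_def)
  moreover have "real (card {x \<in> Pow (grid h). \<bar>row_inner h x y\<bar> \<le> s}) * K * (h / 2)
    \<le> real (card {x \<in> Pow (grid h). \<bar>row_inner h x y\<bar> \<le> s}) * K * sqrt (card (S \<times> {..<h}))"
    using sq K by (intro mult_left_mono) auto
  ultimately have "real (card {x \<in> Pow (grid h). \<bar>row_inner h x y\<bar> \<le> s}) * K * (h / 2) \<le> (s + 2 * K) * 2 ^ (h * h)"
    by simp
  then show ?thesis using K h by (simp add: field_simps)
qed

section \<open>The Bollobas--Erdos gadget\<close>

text \<open>
  A discrete Bollobas--Erdos graph: \<open>N\<close> is the sparse relation of being almost antipodal and \<open>H\<close>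
  the relation of having a positive inner product.
\<close>

locale antipodal_gadget =
  fixes \<epsilon> :: real and \<Omega> :: "'x set" and N H :: "'x \<Rightarrow> 'x \<Rightarrow> bool"
  assumes finite_\<Omega>: "finite \<Omega>" and \<Omega>_nonempty: "\<Omega> \<noteq> {}"
    and N_sym: "N x y \<Longrightarrow> N y x"
    and N_triangle_free: "\<not> (N x y \<and> N y z \<and> N x z)"
    and N_dense: "\<lbrakk>A \<subseteq> \<Omega>; B \<subseteq> \<Omega>; \<epsilon> * card \<Omega> \<le> card A; \<epsilon> * card \<Omega> \<le> card B\<rbrakk> \<Longrightarrow> \<exists>x\<in>A. \<exists>y\<in>B. N x y"
    and N_sparse: "card {(x, z) \<in> \<Omega> \<times> \<Omega>. N x z \<or> (\<exists>y. N x y \<and> N y z)} \<le> \<epsilon> * (card \<Omega>)\<^sup>2"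
    and H_sym: "H x y \<Longrightarrow> H y x"
    and H_half: "(1 / 2 - \<epsilon>) * (card \<Omega>)\<^sup>2 \<le> card {(x, y) \<in> \<Omega> \<times> \<Omega>. H x y}"
    and H_N_free: "\<not> (N x x' \<and> N y y' \<and> H x y \<and> H x y' \<and> H x' y \<and> H x' y')"

lemma norm_sq_add_le: "norm_sq h (\<lambda>i. u i + v i) \<le> 2 * norm_sq h u + 2 * norm_sq h v"
proof -
  have "(p + q)\<^sup>2 \<le> 2 * p\<^sup>2 + 2 * q\<^sup>2" for p q :: real
    using zero_le_power2[of "p - q"] by (simp add: power2_eq_square algebra_simps)
  then show ?thesis
    unfolding norm_sq_def sum_distrib_left sum.distrib[symmetric] by (intro sum_mono)
qed

lemma norm_sq_minus: "norm_sq h (\<lambda>i. - u i) = norm_sq h u"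
  by (simp add: norm_sq_def)

lemma norm_sq_scale: "norm_sq h (\<lambda>i. c * u i) = c\<^sup>2 * norm_sq h u"
  by (simp add: norm_sq_def power_mult_distrib sum_distrib_left)

lemma card_pairs_le:
  fixes c :: real
  assumes "finite A" "finite B" "\<And>x. x \<in> A \<Longrightarrow> card {y \<in> B. P x y} \<le> c"
  shows "card {(x, y) \<in> A \<times> B. P x y} \<le> c * card A"
proof -
  have "{(x, y) \<in> A \<times> B. P x y} = (SIGMA x:A. {y \<in> B. P x y})" by auto
  then have "card {(x, y) \<in> A \<times> B. P x y} = (\<Sum>x\<in>A. card {y \<in> B. P x y})"
    using assms by (simp add: card_SigmaI)
  then have "real (card {(x, y) \<in> A \<times> B. P x y}) = (\<Sum>x\<in>A. real (card {y \<in> B. P x y}))" by simp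
  also have "\<dots> \<le> (\<Sum>x\<in>A. c)" by (intro sum_mono assms)
  finally show ?thesis by (simp add: mult.commute)
qed

text \<open>The constants are chosen in the order \<open>T\<close>, \<open>K\<close>,
  \<open>h\<close>: the squared radius \<open>T * h\<close> comes from the density, \<open>K\<close>
  is large compared with \<open>T\<close>, and \<open>h\<close> is large compared with
  \<open>K\<close>.\<close>

lemma antipodal_gadget_exists:
  assumes \<epsilon>: "\<epsilon> > 0"
  obtains \<Omega> :: "(nat \<times> nat) set set" and N H where "antipodal_gadget \<epsilon> \<Omega> N H"
proof -
  \<comment> \<open>The density is \<open>\<epsilon> / 2\<close>, because points that are not
    \<open>good\<close> are first removed from both sets.\<close>
  define T :: real where "T = (1 + 6 / (\<epsilon> / 2))\<^sup>2"
  define \<delta> where "\<delta> = \<epsilon> / 4"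
  \<comment> \<open>The summand \<open>8 * T\<close> makes \<open>few_near_vector\<close> applicable
    up to squared radius \<open>4 * T * h\<close>; the summand \<open>T / \<delta>\<close> makes
    \<open>T / (2 * K)\<close>, the main term of \<open>few_small_inner\<close>, at most
    \<open>\<delta> / 2\<close>.\<close>
  define K where "K = 8 * T + T / \<delta>"
  have \<delta>: "\<delta> > 0" using \<epsilon> by (simp add: \<delta>_def)
  have T: "T \<ge> 1" unfolding T_def using \<epsilon> by (intro one_le_power) simp
  have K1: "K \<ge> 8 * T" using T \<delta> by (simp add: K_def)
  then have K: "K > 0" using T by simp
  have K2: "K\<^sup>2 > 8 * T"
  proof -
    have "8 * T < (8 * T)\<^sup>2" using T by (simp add: power2_eq_square)
    also have "\<dots> \<le> K\<^sup>2" using K1 T by (intro power_mono) auto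
    finally show ?thesis .
  qed
  have K3: "T / (2 * K) \<le> \<delta> / 2"
  proof -
    have "T / \<delta> \<le> K" using T by (simp add: K_def)
    then show ?thesis using K \<delta> by (simp add: field_simps)
  qed
  \<comment> \<open>The first summand bounds \<open>2 * (K + 2) / sqrt h\<close> by
    \<open>\<delta>\<close>, the second bounds \<open>4 / h\<close> by
    \<open>\<delta> / 2\<close>.\<close>
  define h where "h = nat \<lceil>(2 * (K + 2) / \<delta>)\<^sup>2 + 8 / \<delta>\<rceil>"
  have h_ge: "(2 * (K + 2) / \<delta>)\<^sup>2 + 8 / \<delta> \<le> h" unfolding h_def by linarith
  have "8 / \<delta> > 0" using \<delta> by simp
  then have h: "h > 0" and h8: "8 / \<delta> \<le> h"
    using h_ge zero_le_power2[of "2 * (K + 2) / \<delta>"] by linarith+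
  have sq: "2 * (K + 2) / sqrt h \<le> \<delta>"
  proof -
    have "(2 * (K + 2) / \<delta>)\<^sup>2 \<le> h" using h_ge \<open>8 / \<delta> > 0\<close> by linarith
    then have "2 * (K + 2) / \<delta> \<le> sqrt h" by (rule real_le_rsqrt)
    then show ?thesis using h \<delta> by (simp add: field_simps)
  qed
  define \<Omega> where "\<Omega> = Pow (grid h)"
  define W :: real where "W = card \<Omega>"
  have W: "W = 2 ^ (h * h)" "W > 0" by (simp_all add: W_def \<Omega>_def card_Pow)
  have fin: "finite \<Omega>" by (simp add: \<Omega>_def)
  define r where "r x i = row_sum h i x" for x i
  \<comment> \<open>Short vectors would be almost antipodal to one another and create triangles in
    \<open>N\<close>. The threshold of \<open>H\<close> below is a quarter of the bound
    \<open>T * h\<close> on the inner product of two sums of \<open>N\<close>-pairs.\<close>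
  define good where "good x \<longleftrightarrow> 4 * T * h < norm_sq h (r x)" for x
  define N where "N x y \<longleftrightarrow> good x \<and> good y \<and> norm_sq h (\<lambda>i. r x i + r y i) \<le> T * h" for x y
  define H where "H x y \<longleftrightarrow> T * h / 4 < row_inner h x y" for x y
  have few: "card {x \<in> \<Omega>. norm_sq h (\<lambda>i. r x i - v i) \<le> s * h} \<le> \<delta> * W" if "s \<le> 4 * T" for v and s :: real
  proof -
    have "real (card {x \<in> \<Omega>. norm_sq h (\<lambda>i. r x i - v i) \<le> s * h}) \<le> 2 * (K + 2) / sqrt h * 2 ^ (h * h)"
      unfolding \<Omega>_def r_def using h K K2 that by (intro few_near_vector) auto
    also have "\<dots> \<le> \<delta> * W" unfolding W using sq by (intro mult_right_mono) auto
    finally show ?thesis .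
  qed
  have N_sym: "N y x" if "N x y" for x y
    using that by (simp add: N_def add.commute)
  have "antipodal_gadget \<epsilon> \<Omega> N H"
  proof
    show "finite \<Omega>" by fact
    show "\<Omega> \<noteq> {}" by (auto simp: \<Omega>_def)
    show "N y x" if "N x y" for x y using that by (rule N_sym)
    show "H y x" if "H x y" for x y using that by (simp add: H_def row_inner_def mult.commute)
    show "\<not> (N x y \<and> N y z \<and> N x z)" for x y z
    proof
      assume *: "N x y \<and> N y z \<and> N x z"
      define p q s where "p i = r x i + r y i" and "q i = r x i + r z i" and "s i = - (r y i + r z i)" for i
      have pqs: "norm_sq h p \<le> T * h" "norm_sq h q \<le> T * h" "norm_sq h s \<le> T * h"
        using * unfolding p_def[abs_def] q_def[abs_def] s_def[abs_def] norm_sq_minus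
        by (simp_all add: N_def)
      \<comment> \<open>Twice \<open>x\<close> is the sum of \<open>x + y\<close>,
        \<open>x + z\<close> and \<open>-(y + z)\<close>, which bounds its squared norm by
        \<open>10 * T * h\<close>; goodness makes it exceed \<open>16 * T * h\<close>.\<close>
      have "4 * norm_sq h (r x) = norm_sq h (\<lambda>i. (p i + q i) + s i)"
        by (simp add: norm_sq_scale[of h 2, simplified, symmetric] p_def q_def s_def)
      also have "\<dots> \<le> 2 * norm_sq h (\<lambda>i. p i + q i) + 2 * norm_sq h s" by (rule norm_sq_add_le)
      also have "\<dots> \<le> 2 * (2 * norm_sq h p + 2 * norm_sq h q) + 2 * norm_sq h s"
        using norm_sq_add_le[of h p q] by simp
      finally have "4 * norm_sq h (r x) \<le> 2 * (2 * norm_sq h p + 2 * norm_sq h q) + 2 * norm_sq h s" .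
      moreover have "4 * (T * h) < norm_sq h (r x)" using * by (simp add: N_def good_def)
      moreover have "T * h \<ge> 0" using T by simp
      ultimately show False using pqs by (smt (verit))
    qed
    show "\<not> (N x x' \<and> N y y' \<and> H x y \<and> H x y' \<and> H x' y \<and> H x' y')" for x x' y y'
    proof
      assume *: "N x x' \<and> N y y' \<and> H x y \<and> H x y' \<and> H x' y \<and> H x' y'"
      define p q where "p i = r x i + r x' i" and "q i = r y i + r y' i" for i
      \<comment> \<open>\<open>p\<close> and \<open>q\<close> have norm at most \<open>sqrt (T * h)\<close>, so Cauchy--Schwarz bounds their inner product.\<close>
      have "T * h < row_inner h x y + row_inner h x y' + row_inner h x' y + row_inner h x' y'"
        using * by (simp add: H_def)
      also have "\<dots> = (\<Sum>i<h. p i * q i)"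
        by (simp add: row_inner_def p_def q_def r_def algebra_simps sum.distrib)
      also have "\<dots> \<le> (\<Sum>i<h. ((p i)\<^sup>2 + (q i)\<^sup>2) / 2)"
      proof (intro sum_mono)
        fix i show "p i * q i \<le> ((p i)\<^sup>2 + (q i)\<^sup>2) / 2"
          using zero_le_power2[of "p i - q i"] by (simp add: power2_eq_square algebra_simps)
      qed
      also have "\<dots> = (norm_sq h p + norm_sq h q) / 2"
        by (simp add: norm_sq_def sum.distrib sum_divide_distrib[symmetric])
      also have "\<dots> \<le> T * h"
        using * by (simp add: N_def p_def[abs_def] q_def[abs_def])
      finally show False by simp
    qed
    show "\<exists>x\<in>A. \<exists>y\<in>B. N x y"
      if A: "A \<subseteq> \<Omega>" and B: "B \<subseteq> \<Omega>" and cA: "\<epsilon> * card \<Omega> \<le> card A" and cB: "\<epsilon> * card \<Omega> \<le> card B" for A B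
    proof -
      have bad: "card {x \<in> \<Omega>. \<not> good x} \<le> \<delta> * W"
        using few[of "4 * T" "\<lambda>_. 0"] by (simp add: good_def not_less)
      have good: "\<epsilon> / 2 * W \<le> card {x \<in> C. good x}" if "C \<subseteq> \<Omega>" "\<epsilon> * card \<Omega> \<le> card C" for C
      proof -
        have fC: "finite C" using that fin finite_subset by blast
        have "card C = card ({x \<in> C. good x} \<union> {x \<in> C. \<not> good x})" by (rule arg_cong[of _ _ card]) auto
        also have "\<dots> = card {x \<in> C. good x} + card {x \<in> C. \<not> good x}"
          using fC by (intro card_Un_disjoint) auto
        also have "card {x \<in> C. \<not> good x} \<le> card {x \<in> \<Omega>. \<not> good x}"
          using that fin by (intro card_mono) auto
        finally have "real (card C) \<le> card {x \<in> C. good x} + \<delta> * W" using bad by linarith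
        moreover have "\<delta> * W \<le> \<epsilon> / 2 * W" using W \<epsilon> by (simp add: \<delta>_def)
        ultimately show ?thesis using that(2) by (simp add: W_def field_simps)
      qed
      define A' where "A' = {x \<in> A. good x}"
      \<comment> \<open>Complementing a matrix negates its row sums, so a close pair for
        \<open>A'\<close> and the complements is an almost antipodal pair for \<open>A\<close> and
        \<open>B\<close>.\<close>
      define B' where "B' = (\<lambda>x. grid h - x) ` {x \<in> B. good x}"
      have "inj_on (\<lambda>x. grid h - x) {x \<in> B. good x}"
        using B by (intro inj_onI) (auto simp: \<Omega>_def)
      then have "card B' = card {x \<in> B. good x}" unfolding B'_def by (rule card_image)
      then have "\<epsilon> / 2 * 2 ^ (h * h) \<le> card B'" "\<epsilon> / 2 * 2 ^ (h * h) \<le> card A'"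
        using good[OF A cA] good[OF B cB] by (simp_all add: A'_def W)
      moreover have "A' \<subseteq> Pow (grid h)" "B' \<subseteq> Pow (grid h)"
        using A by (auto simp: A'_def B'_def \<Omega>_def)
      ultimately obtain x y' where xy: "x \<in> A'" "y' \<in> B'"
        "norm_sq h (\<lambda>i. row_sum h i y' - row_sum h i x) \<le> (1 + 6 / (\<epsilon> / 2))\<^sup>2 * h"
        using dense_sets_close[OF h, of "\<epsilon> / 2" A' B'] \<epsilon> by auto
      obtain y where y: "y \<in> B" "good y" "y' = grid h - y" using xy(2) by (auto simp: B'_def)
      have "norm_sq h (\<lambda>i. r x i + r y i) = norm_sq h (\<lambda>i. row_sum h i y' - row_sum h i x)"
        unfolding norm_sq_def by (intro sum.cong refl) (simp add: y(3) row_sum_Diff r_def power2_eq_square algebra_simps)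
      then have "N x y" using xy y by (simp add: N_def A'_def T_def)
      then show ?thesis using xy y by (auto simp: A'_def)
    qed
    show "card {(x, z) \<in> \<Omega> \<times> \<Omega>. N x z \<or> (\<exists>y. N x y \<and> N y z)} \<le> \<epsilon> * (card \<Omega>)\<^sup>2"
    proof -
      have "card {z \<in> \<Omega>. N x z \<or> (\<exists>y. N x y \<and> N y z)} \<le> 2 * \<delta> * W" for x
      proof -
        \<comment> \<open>Pairs with a common \<open>N\<close>-neighbour are counted too, since the
          blow-up excludes them as purple edges inside the large parts. Two such points are close
          together, so every \<open>z\<close> in question lies in a ball around \<open>r x\<close>
          or its negative.\<close>
        have D: "norm_sq h (\<lambda>i. r z i - r x i) \<le> 4 * T * h" if "N x y" "N y z" for y z
        proof -
          have "norm_sq h (\<lambda>i. r z i - r x i) = norm_sq h (\<lambda>i. (r y i + r z i) + - (r x i + r y i))" by simp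
          also have "\<dots> \<le> 2 * norm_sq h (\<lambda>i. r y i + r z i) + 2 * norm_sq h (\<lambda>i. - (r x i + r y i))"
            by (rule norm_sq_add_le)
          also have "\<dots> \<le> 4 * T * h"
            using that unfolding norm_sq_minus by (simp add: N_def)
          finally show ?thesis .
        qed
        have D': "norm_sq h (\<lambda>i. r z i - - r x i) \<le> T * h" if "N x z" for z
          using that by (simp add: N_def add.commute)
        have "{z \<in> \<Omega>. N x z \<or> (\<exists>y. N x y \<and> N y z)}
          \<subseteq> {z \<in> \<Omega>. norm_sq h (\<lambda>i. r z i - - r x i) \<le> T * h} \<union> {z \<in> \<Omega>. norm_sq h (\<lambda>i. r z i - r x i) \<le> 4 * T * h}"
          using D D' by blast
        then have "card {z \<in> \<Omega>. N x z \<or> (\<exists>y. N x y \<and> N y z)}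
          \<le> card ({z \<in> \<Omega>. norm_sq h (\<lambda>i. r z i - - r x i) \<le> T * h} \<union> {z \<in> \<Omega>. norm_sq h (\<lambda>i. r z i - r x i) \<le> 4 * T * h})"
          using fin by (intro card_mono) auto
        also have "\<dots> \<le> card {z \<in> \<Omega>. norm_sq h (\<lambda>i. r z i - - r x i) \<le> T * h} + card {z \<in> \<Omega>. norm_sq h (\<lambda>i. r z i - r x i) \<le> 4 * T * h}"
          by (rule card_Un_le)
        finally show ?thesis using few[of T "\<lambda>i. - r x i"] few[of "4 * T" "r x"] T by simp
      qed
      then have "card {(x, z) \<in> \<Omega> \<times> \<Omega>. N x z \<or> (\<exists>y. N x y \<and> N y z)} \<le> 2 * \<delta> * W * card \<Omega>"
        using fin by (intro card_pairs_le)
      also have "\<dots> \<le> \<epsilon> * (card \<Omega>)\<^sup>2" using \<epsilon> by (simp add: \<delta>_def W_def power2_eq_square)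
      finally show ?thesis .
    qed
    show "(1 / 2 - \<epsilon>) * (card \<Omega>)\<^sup>2 \<le> card {(x, y) \<in> \<Omega> \<times> \<Omega>. H x y}"
    proof -
      define s where "s = T * h / 4"
      have s: "s \<ge> 0" using T by (simp add: s_def)
      \<comment> \<open>\<open>few_small_inner\<close> applies to points with many large rows; the
        flat ones are rare and are counted with all their partners.\<close>
      define flat where "flat y \<longleftrightarrow> h < 2 * card {i \<in> {..<h}. \<bar>row_sum h i y\<bar> \<le> K}" for y
      define P where "P = {(y, x) \<in> \<Omega> \<times> \<Omega>. s < row_inner h x y}"
      define M where "M = {(y, x) \<in> \<Omega> \<times> \<Omega>. row_inner h x y < - s}"
      define Z where "Z = {(y, x) \<in> \<Omega> \<times> \<Omega>. \<bar>row_inner h x y\<bar> \<le> s}"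
      have finP: "finite (\<Omega> \<times> \<Omega>)" using fin by simp
      have "card {y \<in> \<Omega>. flat y} \<le> 2 * (K + 2) / sqrt h * 2 ^ (h * h)"
        using few_small_rows[OF h, of K "\<lambda>_. 0"] K by (simp add: flat_def \<Omega>_def)
      also have "\<dots> \<le> \<delta> * W" unfolding W using sq by (intro mult_right_mono) auto
      finally have flat: "card {y \<in> \<Omega>. flat y} \<le> \<delta> * W" .
      have "Z \<subseteq> {y \<in> \<Omega>. flat y} \<times> \<Omega> \<union> {(y, x) \<in> {y \<in> \<Omega>. \<not> flat y} \<times> \<Omega>. \<bar>row_inner h x y\<bar> \<le> s}"
        by (auto simp: Z_def)
      then have "card Z \<le> card ({y \<in> \<Omega>. flat y} \<times> \<Omega> \<union> {(y, x) \<in> {y \<in> \<Omega>. \<not> flat y} \<times> \<Omega>. \<bar>row_inner h x y\<bar> \<le> s})"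
        using fin by (intro card_mono) (auto intro: finite_subset[OF _ finP])
      also have "\<dots> \<le> card ({y \<in> \<Omega>. flat y} \<times> \<Omega>) + card {(y, x) \<in> {y \<in> \<Omega>. \<not> flat y} \<times> \<Omega>. \<bar>row_inner h x y\<bar> \<le> s}"
        by (rule card_Un_le)
      finally have Z1: "real (card Z) \<le> card {y \<in> \<Omega>. flat y} * W + card {(y, x) \<in> {y \<in> \<Omega>. \<not> flat y} \<times> \<Omega>. \<bar>row_inner h x y\<bar> \<le> s}"
        by (simp add: card_cartesian_product W_def flip: of_nat_mult of_nat_add)
      have "card {(y, x) \<in> {y \<in> \<Omega>. \<not> flat y} \<times> \<Omega>. \<bar>row_inner h x y\<bar> \<le> s} \<le> \<delta> * W * card {y \<in> \<Omega>. \<not> flat y}"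
      proof (rule card_pairs_le)
        fix y assume "y \<in> {y \<in> \<Omega>. \<not> flat y}"
        then have "real (card {x \<in> \<Omega>. \<bar>row_inner h x y\<bar> \<le> s}) \<le> 2 * (s + 2 * K) / (K * h) * 2 ^ (h * h)"
          unfolding \<Omega>_def using h K s by (intro few_small_inner) (auto simp: flat_def)
        also have "2 * (s + 2 * K) / (K * h) = T / (2 * K) + 4 / h"
          using K h by (simp add: s_def field_simps)
        also have "4 / h \<le> \<delta> / 2" using h8 h \<delta> by (simp add: field_simps)
        finally show "real (card {x \<in> \<Omega>. \<bar>row_inner h x y\<bar> \<le> s}) \<le> \<delta> * W"
          using K3 W by (smt (verit) field_sum_of_halves mult_right_mono)
      qed (use fin in auto)
      also have "\<dots> \<le> \<delta> * W * W"
        unfolding W_def using fin \<delta> by (intro mult_left_mono of_nat_mono card_mono) auto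
      finally have "card {(y, x) \<in> {y \<in> \<Omega>. \<not> flat y} \<times> \<Omega>. \<bar>row_inner h x y\<bar> \<le> s} \<le> \<delta> * W * W" .
      moreover have "card {y \<in> \<Omega>. flat y} * W \<le> \<delta> * W * W"
        using flat W(2) by (intro mult_right_mono) auto
      moreover have "2 * \<delta> * W\<^sup>2 = \<delta> * W * W + \<delta> * W * W" by (simp add: power2_eq_square)
      ultimately have Z: "real (card Z) \<le> 2 * \<delta> * W\<^sup>2"
        using Z1 by linarith
      have inner: "row_inner h (grid h - x) y = - row_inner h x y" for x y
        by (simp add: row_inner_def row_sum_Diff sum_negf)
      \<comment> \<open>Complementing one argument exchanges clearly negative and clearly positive
        inner products, so each kind makes up half of the pairs outside the rare set
        \<open>Z\<close>.\<close>
      have "bij_betw (\<lambda>(y, x). (y, grid h - x)) M P"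
        by (rule bij_betw_byWitness[where f' = "\<lambda>(y, x). (y, grid h - x)"])
          (auto simp: M_def P_def \<Omega>_def inner double_diff)
      then have MP: "card M = card P" by (rule bij_betw_same_card)
      have "W\<^sup>2 = card (\<Omega> \<times> \<Omega>)" by (simp add: W_def card_cartesian_product power2_eq_square)
      also have "\<Omega> \<times> \<Omega> = P \<union> (M \<union> Z)" by (auto simp: P_def M_def Z_def)
      also have "card \<dots> \<le> card P + (card M + card Z)"
        by (meson add_left_mono card_Un_le order_trans)
      finally have "W\<^sup>2 \<le> 2 * card P + 2 * \<delta> * W\<^sup>2" using MP Z by simp
      moreover have "0 \<le> \<epsilon> * W\<^sup>2" using \<epsilon> by simp
      ultimately have "(1 / 2 - \<epsilon>) * W\<^sup>2 \<le> card P"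
        by (simp add: \<delta>_def left_diff_distrib)
      moreover have "{(x, y) \<in> \<Omega> \<times> \<Omega>. H x y} = P"
        by (auto simp: P_def H_def s_def row_inner_def mult.commute)
      ultimately show ?thesis by (simp add: W_def)
    qed
  qed
  then show ?thesis by (rule that)
qed

section \<open>Colourings from relations\<close>

text \<open>Vertices outside the copy of \<open>V\<close> receive only blue edges. As
  \<open>s \<ge> 2\<close>, they lie in no \<open>s\<close>-clique of \<open>R \<union> P\<close>,
  but all of them may extend a clique of \<open>B \<union> P\<close>, whence the summand
  \<open>n - card V\<close>. The factor 2 comes from counting ordered pairs.\<close>

lemma purple_sizes_of_relation:
  fixes V :: "'v set" and G N :: "'v \<Rightarrow> 'v \<Rightarrow> bool"
  assumes V: "finite V" "card V \<le> n" and s: "s \<ge> 2"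
    and sym: "\<And>u v. G u v \<Longrightarrow> G v u" "\<And>u v. N u v \<Longrightarrow> N v u"
    and clique: "\<And>K. \<lbrakk>K \<subseteq> V; \<And>u v. \<lbrakk>u \<in> K; v \<in> K; u \<noteq> v\<rbrakk> \<Longrightarrow> G u v\<rbrakk> \<Longrightarrow> card K < s"
    and indep: "\<And>K. \<lbrakk>K \<subseteq> V; \<And>u v. \<lbrakk>u \<in> K; v \<in> K; u \<noteq> v\<rbrakk> \<Longrightarrow> \<not> (G u v \<and> N u v)\<rbrakk>
      \<Longrightarrow> card K + (n - card V) < t"
  shows "\<exists>p \<in> purple_sizes n s t. card {(u, v) \<in> V \<times> V. u \<noteq> v \<and> G u v \<and> \<not> N u v} \<le> 2 * p"
proof -
  define m where "m = card V"
  obtain e where e: "bij_betw e {..<m} V"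
    using ex_bij_betw_nat_finite[OF V(1)] by (auto simp: m_def atLeast0LessThan)
  have e_V: "e a \<in> V" if "a < m" for a using e that by (auto simp: bij_betw_def)
  have e_eq: "e a = e b \<longleftrightarrow> a = b" if "a < m" "b < m" for a b
    using e that by (auto simp: bij_betw_def inj_on_def)
  define adj where "adj a b \<longleftrightarrow> a < m \<and> b < m \<and> a \<noteq> b \<and> G (e a) (e b)" for a b
  define red where "red a b \<longleftrightarrow> adj a b \<and> N (e a) (e b)" for a b
  define pur where "pur a b \<longleftrightarrow> adj a b \<and> \<not> N (e a) (e b)" for a b
  have red_sym: "red a b \<longleftrightarrow> red b a" and pur_sym: "pur a b \<longleftrightarrow> pur b a" for a b
    using sym by (auto simp: red_def pur_def adj_def)
  define R where "R = {{a, b} | a b. red a b}"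
  define P where "P = {{a, b} | a b. pur a b}"
  define B where "B = [{..<n}]\<^bsup>2\<^esup> - (R \<union> P)"
  have R_iff: "{a, b} \<in> R \<longleftrightarrow> red a b" for a b
    using red_sym by (auto simp: R_def doubleton_eq_iff)
  have P_iff: "{a, b} \<in> P \<longleftrightarrow> pur a b" for a b
    using pur_sym by (auto simp: P_def doubleton_eq_iff)
  have RP: "R \<union> P \<subseteq> [{..<n}]\<^bsup>2\<^esup>"
    using V(2) by (auto simp: R_def P_def red_def pur_def adj_def m_def nsets_def)
  have "R \<inter> P = {}"
  proof -
    have False if "x \<in> R" "x \<in> P" for x
      using that P_iff by (auto simp: R_def red_def pur_def)
    then show ?thesis by blast
  qed
  then have col: "rbp_colouring n R B P"
    using RP by (auto simp: rbp_colouring_def B_def)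
  have cf1: "clique_free n s (R \<union> P)"
    unfolding clique_free_def
  proof (intro notI, elim bexE)
    fix K assume K: "K \<in> [{..<n}]\<^bsup>s\<^esup>" and "clique K (R \<union> P)"
    then have adj: "adj a b" if "a \<in> K" "b \<in> K" "a \<noteq> b" for a b
      using that R_iff P_iff by (auto simp: clique_def red_def pur_def)
    have cK: "card K = s" "finite K" using K by (auto simp: nsets_def)
    have lt: "a < m" if a: "a \<in> K" for a
    proof -
      have "K \<noteq> {a}" using cK s by auto
      then obtain b where "b \<in> K" "b \<noteq> a" using a by blast
      then show ?thesis using adj[of a b] a by (auto simp: adj_def)
    qed
    have "card (e ` K) < s"
      using adj lt e_V by (intro clique) (auto simp: adj_def)
    moreover have "card (e ` K) = card K"
      using e_eq lt by (intro card_image inj_onI) auto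
    ultimately show False using cK by simp
  qed
  have cf2: "clique_free n t (B \<union> P)"
    unfolding clique_free_def
  proof (intro notI, elim bexE)
    fix K assume K: "K \<in> [{..<n}]\<^bsup>t\<^esup>" and cl: "clique K (B \<union> P)"
    have nred: "\<not> red a b" if "a \<in> K" "b \<in> K" "a \<noteq> b" for a b
    proof -
      have "{a, b} \<in> B \<union> P" using cl that by (auto simp: clique_def)
      then have "{a, b} \<notin> R" using \<open>R \<inter> P = {}\<close> by (auto simp: B_def)
      then show ?thesis by (simp add: R_iff)
    qed
    have cK: "card K = t" "finite K" "K \<subseteq> {..<n}" using K by (auto simp: nsets_def)
    define K' where "K' = K \<inter> {..<m}"
    have "card (e ` K') + (n - card V) < t"
      using nred e_V by (intro indep) (auto simp: red_def adj_def K'_def)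
    moreover have "card (e ` K') = card K'"
      using e_eq by (intro card_image inj_onI) (auto simp: K'_def)
    moreover have "card K \<le> card K' + (n - card V)"
    proof -
      have "K \<subseteq> K' \<union> {m..<n}" using cK by (auto simp: K'_def)
      then have "card K \<le> card (K' \<union> {m..<n})" using cK by (intro card_mono) (auto simp: K'_def)
      also have "\<dots> \<le> card K' + card {m..<n}" by (rule card_Un_le)
      finally show ?thesis by (simp add: m_def)
    qed
    ultimately show False using cK by simp
  qed
  have finP: "finite P"
    by (rule finite_subset[of _ "[{..<n}]\<^bsup>2\<^esup>"]) (use RP in \<open>simp_all add: finite_imp_finite_nsets\<close>)
  define Q where "Q = {(a, b). pur a b \<and> a < b}"
  have Q: "card Q \<le> card P"
  proof (rule card_inj_on_le)
    show "inj_on (\<lambda>(a, b). {a, b}) Q" by (auto simp: inj_on_def Q_def doubleton_eq_iff)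
    show "(\<lambda>(a, b). {a, b}) ` Q \<subseteq> P" using P_iff by (auto simp: Q_def)
  qed fact
  have finQ: "finite Q"
    by (rule finite_subset[of _ "{..<m} \<times> {..<m}"]) (auto simp: Q_def pur_def adj_def)
  have "{(u, v) \<in> V \<times> V. u \<noteq> v \<and> G u v \<and> \<not> N u v}
      \<subseteq> (\<lambda>(a, b). (e a, e b)) ` Q \<union> (\<lambda>(a, b). (e b, e a)) ` Q"
  proof (intro subsetI)
    fix z assume z: "z \<in> {(u, v) \<in> V \<times> V. u \<noteq> v \<and> G u v \<and> \<not> N u v}"
    then obtain u v where uv: "z = (u, v)" "u \<in> V" "v \<in> V" "u \<noteq> v" "G u v" "\<not> N u v" by auto
    obtain a b where ab: "a < m" "b < m" "u = e a" "v = e b"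
      using e uv(2,3) by (auto simp: bij_betw_def)
    then have "pur a b" using uv by (auto simp: pur_def adj_def)
    then have "a < b \<and> (a, b) \<in> Q \<or> b < a \<and> (b, a) \<in> Q"
      using pur_sym[of a b] by (auto simp: Q_def pur_def adj_def)
    then show "z \<in> (\<lambda>(a, b). (e a, e b)) ` Q \<union> (\<lambda>(a, b). (e b, e a)) ` Q"
      using uv(1) ab by force
  qed
  then have "card {(u, v) \<in> V \<times> V. u \<noteq> v \<and> G u v \<and> \<not> N u v}
    \<le> card ((\<lambda>(a, b). (e a, e b)) ` Q \<union> (\<lambda>(a, b). (e b, e a)) ` Q)"
    using finQ by (intro card_mono) auto
  also have "\<dots> \<le> card ((\<lambda>(a, b). (e a, e b)) ` Q) + card ((\<lambda>(a, b). (e b, e a)) ` Q)"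
    by (rule card_Un_le)
  also have "\<dots> \<le> card Q + card Q"
    using finQ by (intro add_mono card_image_le)
  finally have "card {(u, v) \<in> V \<times> V. u \<noteq> v \<and> G u v \<and> \<not> N u v} \<le> 2 * card P" using Q by simp
  moreover have "card P \<in> purple_sizes n s t"
    using col cf1 cf2 unfolding purple_sizes_def by blast
  ultimately show ?thesis by blast
qed

text \<open>
  Positions \<open>k < 3 * m\<close> lie on a circle. The relation \<open>mid\<close> (distance within \<open>q / 2\<close> of half the
  circumference) is triangle-free for \<open>q < m\<close>, and \<open>far\<close> (circular distance exceeding \<open>q\<close>) excludes all
  pairs with a common \<open>mid\<close>-neighbour.
\<close>

definition far :: "nat \<Rightarrow> nat \<Rightarrow> nat \<Rightarrow> nat \<Rightarrow> bool" where
  "far m q k k' \<longleftrightarrow> int q < \<bar>int k - int k'\<bar> \<and> \<bar>int k - int k'\<bar> < 3 * int m - int q"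

definition mid :: "nat \<Rightarrow> nat \<Rightarrow> nat \<Rightarrow> nat \<Rightarrow> bool" where
  "mid m q k k' \<longleftrightarrow> \<bar>2 * \<bar>int k - int k'\<bar> - 3 * int m\<bar> \<le> int q"

lemma far_sym: "far m q k k' \<longleftrightarrow> far m q k' k"
  by (simp add: far_def abs_minus_commute)

lemma mid_sym: "mid m q k k' \<longleftrightarrow> mid m q k' k"
  by (simp add: mid_def abs_minus_commute)

lemma not_mid_refl: "q < m \<Longrightarrow> \<not> mid m q k k"
  by (simp add: mid_def)

text \<open>Both \<open>a\<close> and \<open>c\<close> lie in the arc of length \<open>q\<close>
  centred opposite \<open>b\<close>.\<close>

lemma mid_mid_not_far: "q < m \<Longrightarrow> mid m q a b \<Longrightarrow> mid m q b c \<Longrightarrow> \<not> far m q a c"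
  unfolding mid_def far_def by (smt (verit) of_nat_less_iff)

text \<open>For \<open>q < m\<close> related positions have circular distance greater than
  \<open>m\<close>, but three points on a circle of circumference \<open>3 * m\<close> include two
  at distance at most \<open>m\<close>.\<close>

lemma mid_triangle_free: "q < m \<Longrightarrow> mid m q a b \<Longrightarrow> mid m q b c \<Longrightarrow> \<not> mid m q a c"
  unfolding mid_def by (smt (verit) of_nat_less_iff)

text \<open>Pairwise circular distances at most \<open>q\<close>, less than a third of the
  circumference, leave no room to wrap around, so the set lies in one arc of \<open>q + 1\<close>
  positions.\<close>

lemma card_le_of_not_far:
  assumes q: "q < m" and S: "S \<subseteq> {..<3 * m}" and nf: "\<And>k k'. \<lbrakk>k \<in> S; k' \<in> S\<rbrakk> \<Longrightarrow> \<not> far m q k k'"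
  shows "card S \<le> q + 1"
proof (cases "S = {}")
  case False
  have fin: "finite S" using S finite_subset by blast
  define a where "a = Min S"
  have a: "a \<in> S" "\<And>k. k \<in> S \<Longrightarrow> a \<le> k" using fin False by (auto simp: a_def)
  \<comment> \<open>The circle is cut open near \<open>a\<close>: a position beyond
    \<open>a + q\<close> is close to \<open>a\<close> only the other way round, so it is moved in
    front of \<open>a\<close>.\<close>
  define f where "f k = (if k \<le> a + q then int k else int k - 3 * int m)" for k
  have lt: "k < 3 * m" if "k \<in> S" for k using S that by auto
  have diff: "f k \<le> f k' + int q" if k: "k \<in> S" "k' \<in> S" for k k'
    using nf[OF k] nf[OF a(1) k(1)] nf[OF a(1) k(2)] a(2)[OF k(1)] a(2)[OF k(2)] lt[OF k(1)] lt[OF k(2)] q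
    unfolding far_def f_def by (simp add: abs_if split: if_splits) linarith+
  have inj: "inj_on f S"
    using lt by (intro inj_onI) (force simp: f_def split: if_splits)
  define b where "b = Min (f ` S)"
  have "b \<in> f ` S" unfolding b_def using fin False by (intro Min_in) auto
  then obtain k0 where k0: "k0 \<in> S" "b = f k0" by blast
  have "f ` S \<subseteq> {b..b + int q}"
  proof
    fix z assume "z \<in> f ` S"
    then obtain k where "k \<in> S" "z = f k" by blast
    moreover have "b \<le> z" unfolding b_def using fin \<open>z \<in> f ` S\<close> by (intro Min_le) auto
    ultimately show "z \<in> {b..b + int q}" using diff[of k k0] k0 by simp
  qed
  then have "card (f ` S) \<le> card {b..b + int q}" by (intro card_mono) auto
  then show ?thesis using inj by (simp add: card_image)
qed simp

lemma card_mid_ge: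
  assumes q: "q < m" and k: "k < 3 * m"
  shows "q \<le> card {k' \<in> {..<3 * m}. mid m q k k'}"
proof -
  \<comment> \<open>This is \<open>(3 * m - q) / 2\<close> rounded up, the least forward distance
    allowed by \<open>mid\<close>. Depending on parity the allowed range has \<open>q\<close> or
    \<open>q + 1\<close> values; the first \<open>q\<close> are used.\<close>
  define a where "a = (3 * m - q + 1) div 2"
  define f where "f t = (if k + (a + t) < 3 * m then k + (a + t) else k + (a + t) - 3 * m)" for t
  have a: "3 * m \<le> 2 * a + q" "2 * a + q \<le> 3 * m + 1" using q unfolding a_def by linarith+
  have "inj_on f {..<q}"
    using a q k by (intro inj_onI) (auto simp: f_def split: if_splits)
  moreover have "f ` {..<q} \<subseteq> {k' \<in> {..<3 * m}. mid m q k k'}"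
    using a q k by (auto simp: f_def mid_def abs_if split: if_splits)
  ultimately have "card {..<q} \<le> card {k' \<in> {..<3 * m}. mid m q k k'}"
    by (intro card_inj_on_le) auto
  then show ?thesis by simp
qed

section \<open>The blow-up\<close>

text \<open>The ratio 2 : 3 balances the purple degrees. For \<open>q = 0\<close> a position in a
  small part misses its own \<open>2 * m\<close> and half of the other \<open>2 * m\<close>, a
  position in a large part misses its own \<open>3 * m\<close>: the loss is \<open>3 * m\<close> in
  both cases.\<close>

definition part_size :: "nat \<Rightarrow> nat \<Rightarrow> nat" where
  "part_size m p = (if p < 2 then 2 * m else 3 * m)"

definition indices :: "nat \<Rightarrow> nat \<Rightarrow> (nat \<times> nat) set" where
  "indices l m = (SIGMA p:{..<l}. {..<part_size m p})"

lemma sum_split_two: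
  fixes f :: "nat \<Rightarrow> 'a :: comm_monoid_add"
  assumes "l \<ge> 2"
  shows "(\<Sum>p<l. f p) = f 0 + f 1 + (\<Sum>p\<in>{2..<l}. f p)"
proof -
  have "{..<l} = {0, 1} \<union> {2..<l}" using assms by auto
  then show ?thesis by (simp add: add.assoc)
qed

lemma finite_indices: "finite (indices l m)"
  by (simp add: indices_def)

lemma card_indices:
  assumes "l \<ge> 2"
  shows "card (indices l m) = (3 * l - 2) * m"
proof -
  have "card (indices l m) = (\<Sum>p<l. part_size m p)" by (simp add: indices_def card_SigmaI)
  also have "\<dots> = 4 * m + (l - 2) * (3 * m)"
    by (simp add: sum_split_two[OF assms] part_size_def)
  also have "\<dots> = (3 * l - 2) * m"
  proof -
    obtain j where "l = j + 2" using assms by (metis le_add_diff_inverse2)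
    then show ?thesis by (simp add: algebra_simps)
  qed
  finally show ?thesis .
qed

lemma card_le_2_if_triangle_free:
  assumes "finite S" "\<And>u v w. \<lbrakk>u \<in> S; v \<in> S; w \<in> S; u \<noteq> v; v \<noteq> w; u \<noteq> w\<rbrakk> \<Longrightarrow> False"
  shows "card S \<le> 2"
proof (rule ccontr)
  assume "\<not> card S \<le> 2"
  then have "3 \<le> card S" by simp
  then obtain T where T: "T \<subseteq> S" "card T = 3"
    by (rule obtain_subset_with_card_n)
  then obtain u v w where "T = {u, v, w}" "u \<noteq> v" "v \<noteq> w" "u \<noteq> w"
    unfolding card_3_iff by blast
  with T assms(2)[of u v w] show False by simp
qed

section \<open>Clique number and red independence number of the blow-up\<close>

context antipodal_gadget
begin

text \<open>
  Vertices \<open>((p, k), x)\<close> consist of a part \<open>p\<close>, a position \<open>k\<close> and a point \<open>x\<close> of the gadget. In the parts 0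
  and 1 the positions below \<open>q\<close> form an independent set joined to everything outside the part.
  Edges satisfying \<open>near\<close> will be red, the other ones purple.
\<close>

definition adj :: "nat \<Rightarrow> nat \<Rightarrow> (nat \<times> nat) \<times> 'x \<Rightarrow> (nat \<times> nat) \<times> 'x \<Rightarrow> bool" where
  "adj m q = (\<lambda>((p, k), x) ((p', k'), x').
     if p \<noteq> p' then (p < 2 \<and> p' < 2 \<and> q \<le> k \<and> q \<le> k' \<longrightarrow> H x x')
     else if p < 2 then q \<le> k \<and> q \<le> k' \<and> N x x'
     else far m q k k' \<and> N x x' \<or> mid m q k k' \<and> \<not> N x x' \<and> \<not> (\<exists>y. N x y \<and> N y x'))"

definition near :: "(nat \<times> nat) \<times> 'x \<Rightarrow> (nat \<times> nat) \<times> 'x \<Rightarrow> bool" where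
  "near u v = N (snd u) (snd v)"

lemma N_irrefl: "\<not> N x x"
  using N_triangle_free[of x x x] by simp

lemma near_sym: "near u v \<Longrightarrow> near v u"
  using N_sym by (auto simp: near_def)

lemma adj_sym:
  assumes adj: "adj m q u v"
  shows "adj m q v u"
proof -
  obtain p k x p' k' x' where u: "u = ((p, k), x)" and v: "v = ((p', k'), x')"
    by (metis prod.collapse)
  have "N x x' \<longleftrightarrow> N x' x" "H x x' \<longleftrightarrow> H x' x" "(\<exists>y. N x y \<and> N y x') \<longleftrightarrow> (\<exists>y. N x' y \<and> N y x)"
    using N_sym H_sym by blast+
  then show ?thesis
    using adj far_sym[of m q k k'] mid_sym[of m q k k'] by (auto simp: adj_def u v split: if_splits)
qed

lemma adj_first_parts:
  assumes "fst (fst u) = p" "fst (fst v) = p" "p < 2"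
  shows "adj m q u v \<longleftrightarrow> q \<le> snd (fst u) \<and> q \<le> snd (fst v) \<and> N (snd u) (snd v)"
  using assms by (simp add: adj_def case_prod_unfold)

text \<open>In a large part each kind of triangle fails for its own reason: three red edges
  contradict \<open>N_triangle_free\<close>, two red edges give the ends of the purple one a common
  \<open>N\<close>-neighbour, two purple edges put the ends of the red one too close on the circle,
  and three purple edges would be a triangle in \<open>mid\<close>.\<close>

lemma adj_triangle_free:
  assumes q: "q < m" and "fst (fst u) = p" "fst (fst v) = p" "fst (fst w) = p"
  shows "\<not> (adj m q u v \<and> adj m q v w \<and> adj m q u w)"
proof
  assume adj: "adj m q u v \<and> adj m q v w \<and> adj m q u w"
  obtain k x where u: "u = ((p, k), x)" using assms(2) by (metis prod.collapse)
  obtain k' x' where v: "v = ((p, k'), x')" using assms(3) by (metis prod.collapse)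
  obtain k'' x'' where w: "w = ((p, k''), x'')" using assms(4) by (metis prod.collapse)
  note nt = N_triangle_free[of x x' x'']
  note idx = mid_mid_not_far[OF q] mid_triangle_free[OF q]
  show False
  proof (cases "p < 2")
    case True
    then show False using adj nt by (simp add: adj_def u v w)
  next
    case False
    define mm where "mm k x k' x' \<longleftrightarrow> mid m q k k' \<and> \<not> N x x' \<and> \<not> (\<exists>y. N x y \<and> N y x')" for k k' x x'
    define ff where "ff k x k' x' \<longleftrightarrow> far m q k k' \<and> N x x'" for k k' x x'
    have a: "ff k x k' x' \<or> mm k x k' x'" "ff k' x' k'' x'' \<or> mm k' x' k'' x''" "ff k x k'' x'' \<or> mm k x k'' x''"
      using adj False by (simp_all add: adj_def u v w mm_def ff_def)
    have sym: "mm k x k' x' \<Longrightarrow> mm k' x' k x" "ff k x k' x' \<Longrightarrow> ff k' x' k x" for k k' x x'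
      using N_sym far_sym[of m q k k'] mid_sym[of m q k k'] unfolding mm_def ff_def by blast+
    have 1: "\<not> (ff k x k' x' \<and> ff k' x' k'' x'' \<and> ff k x k'' x'')" using nt by (auto simp: ff_def)
    have 2: "\<not> (ff k x k' x' \<and> ff k' x' k'' x'' \<and> mm k x k'' x'')" for k x k' x' k'' x''
      by (auto simp: ff_def mm_def)
    have 3: "\<not> (mm k x k' x' \<and> mm k' x' k'' x'' \<and> ff k x k'' x'')" for k x k' x' k'' x''
      using idx(1) by (auto simp: ff_def mm_def)
    have 4: "\<not> (mm k x k' x' \<and> mm k' x' k'' x'' \<and> mm k x k'' x'')"
      using idx(2) by (auto simp: mm_def)
    show False using a sym 1 2 3 4 by meson
  qed
qed

text \<open>Each part contributes at most 2 vertices and the first two parts together at most 3, so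
  the total is at most \<open>3 + 2 * (l - 2) = 2 * l - 1\<close>.\<close>

lemma card_clique_less:
  assumes l: "l \<ge> 2" and q: "q < m" and K: "K \<subseteq> indices l m \<times> \<Omega>"
    and adj: "\<And>u v. \<lbrakk>u \<in> K; v \<in> K; u \<noteq> v\<rbrakk> \<Longrightarrow> adj m q u v"
  shows "card K < 2 * l"
proof -
  have fin: "finite K" using K finite_subset finite_indices finite_\<Omega> by blast
  define C where "C p = {v \<in> K. fst (fst v) = p}" for p
  have two: "card (C p) \<le> 2" for p
  proof (rule card_le_2_if_triangle_free)
    fix u v w assume "u \<in> C p" "v \<in> C p" "w \<in> C p" "u \<noteq> v" "v \<noteq> w" "u \<noteq> w"
    then show False using adj_triangle_free[OF q, of u p v w] adj by (auto simp: C_def)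
  qed (use fin in \<open>simp add: C_def\<close>)
  have three: "card (C 0) + card (C 1) \<le> 3"
  proof (rule ccontr)
    assume "\<not> ?thesis"
    then have "card (C 0) = 2" "card (C 1) = 2" using two[of 0] two[of 1] by linarith+
    then obtain u u' v v' where uv: "C 0 = {u, u'}" "u \<noteq> u'" "C 1 = {v, v'}" "v \<noteq> v'"
      unfolding card_2_iff by blast
    have in0: "w \<in> K" "fst (fst w) = 0" if "w \<in> {u, u'}" for w using that uv(1) by (auto simp: C_def)
    have in1: "w \<in> K" "fst (fst w) = 1" if "w \<in> {v, v'}" for w using that uv(3) by (auto simp: C_def)
    \<comment> \<open>An inner edge of a small part avoids the special positions below
      \<open>q\<close>, so all four cross edges must satisfy \<open>H\<close>, which contradicts
      \<open>H_N_free\<close>.\<close>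
    have "adj m q u u'" "adj m q v v'"
      using adj[of u u'] adj[of v v'] uv in0[of u] in0[of u'] in1[of v] in1[of v'] by simp_all
    then have NN: "N (snd u) (snd u')" "N (snd v) (snd v')"
      and ge: "\<And>w. w \<in> {u, u', v, v'} \<Longrightarrow> q \<le> snd (fst w)"
      using adj_first_parts[of u 0 u' m q] adj_first_parts[of v 1 v' m q]
        in0[of u] in0[of u'] in1[of v] in1[of v'] by auto
    have "H (snd w) (snd z)" if w: "w \<in> {u, u'}" and z: "z \<in> {v, v'}" for w z
    proof -
      have "w \<noteq> z" using in0[OF w] in1[OF z] by auto
      then have "adj m q w z" using adj in0[OF w] in1[OF z] by blast
      moreover have "q \<le> snd (fst w)" "q \<le> snd (fst z)" using ge w z by blast+
      ultimately show ?thesis using in0[OF w] in1[OF z] by (simp add: adj_def case_prod_unfold)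
    qed
    then show False using H_N_free[of "snd u" "snd u'" "snd v" "snd v'"] NN by blast
  qed
  have "K = (\<Union>p<l. C p)" using K by (auto simp: C_def indices_def)
  then have "card K \<le> (\<Sum>p<l. card (C p))" using card_UN_le[of "{..<l}" C] by simp
  also have "\<dots> = card (C 0) + card (C 1) + (\<Sum>p\<in>{2..<l}. card (C p))" by (rule sum_split_two[OF l])
  also have "\<dots> \<le> 3 + (\<Sum>p\<in>{2..<l}. 2)" using three two by (intro add_mono sum_mono) auto
  also have "\<dots> < 2 * l" using l by simp
  finally show ?thesis .
qed

text \<open>A position with fewer than \<open>\<epsilon> * card \<Omega>\<close> points of
  \<open>K\<close> contributes only to the error. Any two rich positions, equal or not, contain an
  \<open>N\<close>-pair by \<open>N_dense\<close>, which must be non-adjacent. Hence rich positions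
  in a small part are special, all rich positions share one part, and in a large part no two of them
  are far apart.\<close>

lemma card_independent_le:
  assumes \<epsilon>: "\<epsilon> > 0" and q: "q < m" and K: "K \<subseteq> indices l m \<times> \<Omega>"
    and indep: "\<And>u v. \<lbrakk>u \<in> K; v \<in> K; u \<noteq> v\<rbrakk> \<Longrightarrow> \<not> (adj m q u v \<and> near u v)"
  shows "real (card K) \<le> (real q + 1 + \<epsilon> * card (indices l m)) * card \<Omega>"
proof -
  define I where "I = indices l m"
  define X where "X i = {x \<in> \<Omega>. (i, x) \<in> K}" for i
  define S where "S = {i \<in> I. \<epsilon> * card \<Omega> \<le> card (X i)}"
  have finI: "finite I" by (simp add: I_def finite_indices)
  have finX: "finite (X i)" for i using finite_\<Omega> by (simp add: X_def)
  have W: "card \<Omega> > 0" using finite_\<Omega> \<Omega>_nonempty by (simp add: card_gt_0_iff)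
  have nadj: "\<exists>x y. N x y \<and> \<not> adj m q (i, x) (j, y)" if ij: "i \<in> S" "j \<in> S" for i j
  proof -
    have "X i \<subseteq> \<Omega>" "X j \<subseteq> \<Omega>" "\<epsilon> * card \<Omega> \<le> card (X i)" "\<epsilon> * card \<Omega> \<le> card (X j)"
      using ij by (auto simp: S_def X_def)
    from N_dense[OF this] obtain x y where xy: "x \<in> X i" "y \<in> X j" "N x y"
      by blast
    then have "(i, x) \<noteq> (j, y)" using N_irrefl by auto
    then have "\<not> adj m q (i, x) (j, y)"
      using indep[of "(i, x)" "(j, y)"] xy by (auto simp: X_def near_def)
    with xy show ?thesis by blast
  qed
  have small: "k < q" if "(p, k) \<in> S" "p < 2" for p k
    using nadj[OF that(1) that(1)] that(2) by (auto simp: adj_def)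
  have same: "p = p'" if i: "(p, k) \<in> S" "(p', k') \<in> S" for p k p' k'
    using nadj[OF i] small[OF i(1)] by (auto simp: adj_def split: if_splits)
  have "card S \<le> q + 1"
  proof (cases "S = {}")
    case False
    then obtain p k0 where pk: "(p, k0) \<in> S" by auto
    have fs: "i = (p, snd i)" if "i \<in> S" for i
      using same[OF pk, of "fst i" "snd i"] that by (auto simp: prod_eq_iff)
    have "inj_on snd S" using fs by (metis inj_onI)
    then have cS: "card (snd ` S) = card S" by (rule card_image)
    show ?thesis
    proof (cases "p < 2")
      case True
      then have "snd ` S \<subseteq> {..<q}" using fs small by fastforce
      then have "card (snd ` S) \<le> card {..<q}" by (intro card_mono) auto
      then show ?thesis using cS by simp
    next
      case False
      have "card (snd ` S) \<le> q + 1"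
      proof (rule card_le_of_not_far[OF q])
        show "snd ` S \<subseteq> {..<3 * m}"
        proof
          fix k assume "k \<in> snd ` S"
          then obtain i where "i \<in> S" "k = snd i" by blast
          then have "(p, k) \<in> I" using fs[of i] by (auto simp: S_def)
          then show "k \<in> {..<3 * m}" using False by (auto simp: I_def indices_def part_size_def)
        qed
      next
        fix k k' assume "k \<in> snd ` S" "k' \<in> snd ` S"
        then obtain i j where "i \<in> S" "k = snd i" "j \<in> S" "k' = snd j" by blast
        then have "(p, k) \<in> S" "(p, k') \<in> S" using fs[of i] fs[of j] by simp_all
        from nadj[OF this] show "\<not> far m q k k'" using False by (auto simp: adj_def)
      qed
      then show ?thesis using cS by simp
    qed
  qed simp
  then have cS: "real (card S) \<le> real q + 1" by linarith
  have "K = (SIGMA i:I. X i)" using K by (auto simp: X_def I_def)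
  then have "real (card K) = (\<Sum>i\<in>I. real (card (X i)))" using finI finX by (simp add: card_SigmaI)
  also have "\<dots> \<le> (\<Sum>i\<in>I. \<epsilon> * card \<Omega> + (if i \<in> S then real (card \<Omega>) else 0))"
  proof (intro sum_mono)
    fix i assume i: "i \<in> I"
    have "card (X i) \<le> card \<Omega>" using finite_\<Omega> by (intro card_mono) (auto simp: X_def)
    moreover have "0 \<le> \<epsilon> * card \<Omega>" using \<epsilon> by simp
    ultimately show "real (card (X i)) \<le> \<epsilon> * card \<Omega> + (if i \<in> S then real (card \<Omega>) else 0)"
      using i by (auto simp: S_def)
  qed
  also have "\<dots> = \<epsilon> * card \<Omega> * card I + real (card S) * card \<Omega>"
  proof -
    have "(\<Sum>i\<in>I. if i \<in> S then real (card \<Omega>) else 0) = (\<Sum>i\<in>I \<inter> S. real (card \<Omega>))"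
      by (rule sum.inter_restrict[OF finI, symmetric])
    moreover have "I \<inter> S = S" by (auto simp: S_def)
    ultimately show ?thesis by (simp add: sum.distrib)
  qed
  also have "\<dots> \<le> \<epsilon> * card \<Omega> * card I + (real q + 1) * card \<Omega>"
    using cS by (intro add_mono mult_right_mono) auto
  finally show ?thesis by (simp add: I_def algebra_simps)
qed

end

section \<open>Counting purple edges\<close>

text \<open>The limiting purple density between two copies of \<open>\<Omega>\<close> as
  \<open>\<epsilon>\<close> tends to 0. Pairs adjacent only through \<open>N\<close> are red and
  count 0.\<close>

definition pair_weight :: "nat \<Rightarrow> nat \<Rightarrow> nat \<times> nat \<Rightarrow> nat \<times> nat \<Rightarrow> real" where
  "pair_weight m q = (\<lambda>(p, k) (p', k').
     if p \<noteq> p' then (if p < 2 \<and> p' < 2 \<and> q \<le> k \<and> q \<le> k' then 1 / 2 else 1)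
     else if p < 2 then 0 else of_bool (mid m q k k'))"

text \<open>With \<open>q = 0\<close> every position has weight \<open>M - 3 * m\<close>, giving the
  first term. Positive \<open>q\<close> adds at least \<open>q\<close> per position in the large
  parts through \<open>mid\<close>, and \<open>4 * m * q - q * q\<close> over the two small parts
  through the special positions; together this is \<open>M * q\<close> minus the square of
  \<open>q\<close>.\<close>

lemma sum_pair_weight_ge:
  assumes l: "l \<ge> 2" and q: "q < m"
  defines "M \<equiv> (3 * real l - 2) * m"
  shows "(3 * real l - 5) / (3 * real l - 2) * M\<^sup>2 + M * q - (real q)\<^sup>2
    \<le> (\<Sum>i\<in>indices l m. \<Sum>j\<in>indices l m. pair_weight m q i j)"
proof -
  define t where "t p p' = (\<Sum>k<part_size m p. \<Sum>k'<part_size m p'. pair_weight m q (p, k) (p', k'))" for p p'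
  have "(\<Sum>i\<in>indices l m. \<Sum>j\<in>indices l m. pair_weight m q i j)
      = (\<Sum>p<l. \<Sum>k<part_size m p. \<Sum>p'<l. \<Sum>k'<part_size m p'. pair_weight m q (p, k) (p', k'))"
  proof -
    have "(\<Sum>i\<in>indices l m. f i) = (\<Sum>p<l. \<Sum>k<part_size m p. f (p, k))" for f :: "nat \<times> nat \<Rightarrow> real"
      using sum.Sigma[of "{..<l}" "\<lambda>p. {..<part_size m p}" "\<lambda>p k. f (p, k)"]
      by (simp add: indices_def)
    then show ?thesis by simp
  qed
  also have "\<dots> = (\<Sum>p<l. \<Sum>p'<l. t p p')"
    unfolding t_def by (intro sum.cong refl sum.swap)
  finally have eq: "(\<Sum>i\<in>indices l m. \<Sum>j\<in>indices l m. pair_weight m q i j) = (\<Sum>p<l. \<Sum>p'<l. t p p')" .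
  \<comment> \<open>All \<open>4 * m * m\<close> position pairs of the two small parts, minus half
    of those in which both positions are ordinary.\<close>
  define a :: real where "a = 4 * (real m)\<^sup>2 - (2 * real m - q)\<^sup>2 / 2"
  have t_same: "t p p \<ge> 3 * real m * q" if "p \<ge> 2" for p
  proof -
    have "(\<Sum>k<3 * m. real q) \<le> (\<Sum>k<3 * m. \<Sum>k'<3 * m. of_bool (mid m q k k'))"
    proof (intro sum_mono)
      fix k assume "k \<in> {..<3 * m}"
      then have "q \<le> card {k' \<in> {..<3 * m}. mid m q k k'}" using card_mid_ge[OF q] by simp
      also have "card {k' \<in> {..<3 * m}. mid m q k k'} = (\<Sum>k'<3 * m. of_bool (mid m q k k'))"
        by (simp add: sum.inter_filter[symmetric] of_bool_def)
      finally have "real q \<le> real (\<Sum>k'<3 * m. of_bool (mid m q k k'))" by (rule of_nat_mono)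
      then show "real q \<le> (\<Sum>k'<3 * m. of_bool (mid m q k k'))" by simp
    qed
    then show ?thesis using that by (simp add: t_def pair_weight_def part_size_def)
  qed
  have t_first: "t p p \<ge> 0" for p
    by (auto simp: t_def pair_weight_def intro!: sum_nonneg)
  have t_full: "t p p' = real (part_size m p) * real (part_size m p')" if "p \<noteq> p'" "p \<ge> 2 \<or> p' \<ge> 2" for p p'
    using that by (auto simp: t_def pair_weight_def)
  have t_half: "t p p' = a" if "p \<noteq> p'" "p < 2" "p' < 2" for p p'
  proof -
    have s: "(\<Sum>k<2 * m. of_bool (q \<le> k)) = 2 * real m - q"
    proof -
      have "(\<Sum>k<2 * m. of_bool (q \<le> k)) = (\<Sum>k\<in>{k \<in> {..<2 * m}. q \<le> k}. 1 :: real)"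
        by (subst sum.inter_filter) (simp_all add: of_bool_def)
      also have "{k \<in> {..<2 * m}. q \<le> k} = {q..<2 * m}" by auto
      finally show ?thesis using q by simp
    qed
    have "t p p' = (\<Sum>k<2 * m. \<Sum>k'<2 * m. 1 - of_bool (q \<le> k) * of_bool (q \<le> k') / 2)"
      using that by (auto simp: t_def pair_weight_def part_size_def intro!: sum.cong)
    also have "\<dots> = (2 * real m) * (2 * real m) - (\<Sum>k<2 * m. of_bool (q \<le> k)) * (\<Sum>k'<2 * m. of_bool (q \<le> k')) / 2"
    proof -
      have "(\<Sum>k<n. \<Sum>k'<n. 1 - f k * f k' / 2) = real n * real n - (\<Sum>k<n. f k) * (\<Sum>k'<n. f k') / 2"
        for f :: "nat \<Rightarrow> real" and n
        by (simp add: sum_subtractf sum_product sum_divide_distrib)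
      from this[of "\<lambda>k. of_bool (q \<le> k)" "2 * m"] show ?thesis by simp
    qed
    also have "\<dots> = a" unfolding s by (simp add: a_def power2_eq_square)
    finally show ?thesis .
  qed
  define L where "L = real (l - 2)"
  have L: "L = real l - 2" using l by (simp add: L_def)
  have row01: "(\<Sum>p'<l. t p p') \<ge> a + 6 * (real m)\<^sup>2 * L" if p: "p < 2" for p
  proof -
    have "(\<Sum>p'\<in>{2..<l}. t p p') = (\<Sum>p'\<in>{2..<l}. 6 * (real m)\<^sup>2)"
      using p by (intro sum.cong refl) (simp add: t_full part_size_def power2_eq_square)
    then have "(\<Sum>p'\<in>{2..<l}. t p p') = 6 * (real m)\<^sup>2 * L" by (simp add: L_def)
    moreover have "t p 0 + t p 1 \<ge> a"
      using p t_first[of 0] t_first[of 1] t_half[of 0 1] t_half[of 1 0] by (auto simp: less_2_cases_iff)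
    ultimately show ?thesis by (simp add: sum_split_two[OF l])
  qed
  have row2: "(\<Sum>p'<l. t p p') \<ge> 12 * (real m)\<^sup>2 + 9 * (real m)\<^sup>2 * (L - 1) + 3 * real m * q"
    if p: "p \<in> {2..<l}" for p
  proof -
    have "(\<Sum>p'\<in>{2..<l}. t p p') = t p p + (\<Sum>p'\<in>{2..<l} - {p}. t p p')"
      using p by (subst sum.remove[of _ p]) auto
    also have "(\<Sum>p'\<in>{2..<l} - {p}. t p p') = (\<Sum>p'\<in>{2..<l} - {p}. 9 * (real m)\<^sup>2)"
      using p by (intro sum.cong refl) (simp add: t_full part_size_def power2_eq_square)
    also have "\<dots> = 9 * (real m)\<^sup>2 * (L - 1)"
      using p by (simp add: L_def of_nat_diff)
    finally have "(\<Sum>p'\<in>{2..<l}. t p p') \<ge> 3 * real m * q + 9 * (real m)\<^sup>2 * (L - 1)"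
      using t_same[of p] p by simp
    moreover have "t p 0 + t p 1 = 12 * (real m)\<^sup>2"
      using p by (simp add: t_full part_size_def power2_eq_square)
    ultimately show ?thesis by (simp add: sum_split_two[OF l])
  qed
  have "2 * (a + 6 * (real m)\<^sup>2 * L) + L * (12 * (real m)\<^sup>2 + 9 * (real m)\<^sup>2 * (L - 1) + 3 * real m * q)
      \<le> (\<Sum>p<l. \<Sum>p'<l. t p p')"
  proof -
    have "(\<Sum>p\<in>{2..<l}. 12 * (real m)\<^sup>2 + 9 * (real m)\<^sup>2 * (L - 1) + 3 * real m * q)
        \<le> (\<Sum>p\<in>{2..<l}. \<Sum>p'<l. t p p')"
      by (intro sum_mono row2)
    also have "(\<Sum>p\<in>{2..<l}. b) = L * b" for b
      by (simp add: L_def)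
    finally have "L * (12 * (real m)\<^sup>2 + 9 * (real m)\<^sup>2 * (L - 1) + 3 * real m * q)
        \<le> (\<Sum>p\<in>{2..<l}. \<Sum>p'<l. t p p')" .
    moreover have "a + 6 * (real m)\<^sup>2 * L \<le> (\<Sum>p'<l. t 0 p')" "a + 6 * (real m)\<^sup>2 * L \<le> (\<Sum>p'<l. t 1 p')"
      by (rule row01, simp)+
    moreover have "2 * b + x \<le> s0 + s1 + s" if "x \<le> s" "b \<le> s0" "b \<le> s1" for b x s s0 s1 :: real
      using that by linarith
    ultimately show ?thesis
      unfolding sum_split_two[OF l, of "\<lambda>p. \<Sum>p'<l. t p p'"] by blast
  qed
  moreover have "(3 * real l - 5) / (3 * real l - 2) * M\<^sup>2 = (3 * real l - 5) * (3 * real l - 2) * (real m)\<^sup>2"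
  proof -
    have "3 * real l - 2 \<noteq> 0" using l by linarith
    then show ?thesis by (simp add: M_def power2_eq_square)
  qed
  moreover have "(3 * real l - 5) * (3 * real l - 2) * (real m)\<^sup>2 + M * q - (real q)\<^sup>2
      = 2 * (a + 6 * (real m)\<^sup>2 * L) + L * (12 * (real m)\<^sup>2 + 9 * (real m)\<^sup>2 * (L - 1) + 3 * real m * q)"
    unfolding L M_def a_def by (simp add: power2_eq_square field_simps)
  ultimately show ?thesis using eq by simp
qed

context antipodal_gadget
begin

text \<open>Each pair of positions falls short of its weight by at most
  \<open>2 * \<epsilon>\<close>: one \<open>\<epsilon>\<close> for the pairs removed by
  \<open>N_sparse\<close>, one for the deficit in \<open>H_half\<close>.\<close>

lemma card_purple_pairs_ge:
  assumes \<epsilon>: "\<epsilon> > 0" and l: "l \<ge> 2" and q: "q < m"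
  defines "V \<equiv> indices l m \<times> \<Omega>" and "M \<equiv> (3 * real l - 2) * m"
  shows "((3 * real l - 5) / (3 * real l - 2) * M\<^sup>2 + M * q - (real q)\<^sup>2 - 2 * \<epsilon> * M\<^sup>2) * (card \<Omega>)\<^sup>2
    \<le> card {(u, v) \<in> V \<times> V. u \<noteq> v \<and> adj m q u v \<and> \<not> near u v}"
proof -
  define I where "I = indices l m"
  have finI: "finite I" by (simp add: I_def finite_indices)
  have cI: "real (card I) = M"
    using l by (simp add: I_def card_indices[OF l] M_def of_nat_diff)
  define W :: real where "W = card \<Omega>"
  define C where "C i j = {(x, y) \<in> \<Omega> \<times> \<Omega>. adj m q (i, x) (j, y) \<and> \<not> N x y}" for i j
  have finC: "finite (C i j)" for i j
    by (rule finite_subset[of _ "\<Omega> \<times> \<Omega>"]) (use finite_\<Omega> in \<open>auto simp: C_def\<close>)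
  define D where "D = {(x, z) \<in> \<Omega> \<times> \<Omega>. N x z \<or> (\<exists>y. N x y \<and> N y z)}"
  define E where "E = {(x, y) \<in> \<Omega> \<times> \<Omega>. H x y}"
  have fin: "finite (\<Omega> \<times> \<Omega>)" "finite D" "finite E"
    using finite_\<Omega> by (auto simp: D_def E_def intro: finite_subset[of _ "\<Omega> \<times> \<Omega>"])
  have D: "card D \<le> \<epsilon> * W\<^sup>2" using N_sparse by (simp add: D_def W_def)
  have E: "(1 / 2 - \<epsilon>) * W\<^sup>2 \<le> card E" using H_half by (simp add: E_def W_def)
  have minus: "real (card X) - card D \<le> card (C i j)" if "X - D \<subseteq> C i j" "finite X" for X i j
  proof -
    have "card X \<le> card ((X - D) \<union> D)" using that fin by (intro card_mono) auto
    also have "\<dots> \<le> card (X - D) + card D" by (rule card_Un_le)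
    also have "card (X - D) \<le> card (C i j)" using that finC by (intro card_mono) auto
    finally show ?thesis by linarith
  qed
  have cO: "real (card (\<Omega> \<times> \<Omega>)) = W\<^sup>2" by (simp add: W_def card_cartesian_product power2_eq_square)
  have W2: "\<epsilon> * W\<^sup>2 \<ge> 0" using \<epsilon> by simp
  have one: "(pair_weight m q i j - 2 * \<epsilon>) * W\<^sup>2 \<le> card (C i j)" for i j
  proof -
    obtain p k p' k' where ij: "i = (p, k)" "j = (p', k')" by (metis prod.collapse)
    consider (zero) "pair_weight m q i j = 0"
      | (half) "pair_weight m q i j = 1 / 2" "E - D \<subseteq> C i j"
      | (one) "pair_weight m q i j = 1" "\<Omega> \<times> \<Omega> - D \<subseteq> C i j"
      by (cases "p = p'"; cases "p < 2"; cases "p' < 2 \<and> q \<le> k \<and> q \<le> k'"; cases "mid m q k k'")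
        (auto simp: ij pair_weight_def C_def D_def E_def adj_def)
    then show ?thesis
    proof cases
      case zero
      have "(0 - 2 * \<epsilon>) * W\<^sup>2 \<le> 0" using W2 by simp
      then show ?thesis using zero by (smt (verit) of_nat_0_le_iff)
    next
      case half
      then show ?thesis
        using minus[OF half(2) fin(3)] E D unfolding half(1) left_diff_distrib by linarith
    next
      case one
      then show ?thesis using minus[OF one(2) fin(1)] cO D W2 by (simp add: left_diff_distrib)
    qed
  qed
  define S where "S = {(u, v) \<in> V \<times> V. u \<noteq> v \<and> adj m q u v \<and> \<not> near u v}"
  have ne: "u \<noteq> v" if "adj m q u v" "\<not> near u v" for u v
    using that not_mid_refl[OF q] by (auto simp: adj_def near_def case_prod_unfold split: if_splits)
  define f where "f = (\<lambda>(i :: nat \<times> nat, j :: nat \<times> nat, x :: 'x, y :: 'x). ((i, x), (j, y)))"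
  have "S = f ` (SIGMA i:I. SIGMA j:I. C i j)"
  proof (rule set_eqI)
    fix z :: "((nat \<times> nat) \<times> 'x) \<times> ((nat \<times> nat) \<times> 'x)"
    obtain i x j y where z: "z = ((i, x), (j, y))" by (metis prod.collapse)
    have "z \<in> f ` X \<longleftrightarrow> (i, j, x, y) \<in> X" for X
      by (force simp: z f_def)
    then show "z \<in> S \<longleftrightarrow> z \<in> f ` (SIGMA i:I. SIGMA j:I. C i j)"
      using ne[of "(i, x)" "(j, y)"] by (auto simp: z S_def V_def I_def C_def near_def)
  qed
  moreover have "inj_on f X" for X by (auto simp: f_def inj_on_def)
  ultimately have "card S = card (SIGMA i:I. SIGMA j:I. C i j)" by (simp add: card_image)
  also have "\<dots> = (\<Sum>i\<in>I. \<Sum>j\<in>I. card (C i j))"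
    using finI finC by (simp add: card_SigmaI finite_SigmaI)
  finally have "real (card S) = (\<Sum>i\<in>I. \<Sum>j\<in>I. real (card (C i j)))" by simp
  also have "\<dots> \<ge> (\<Sum>i\<in>I. \<Sum>j\<in>I. (pair_weight m q i j - 2 * \<epsilon>) * W\<^sup>2)"
    by (intro sum_mono one)
  also have "(\<Sum>i\<in>I. \<Sum>j\<in>I. (pair_weight m q i j - 2 * \<epsilon>) * W\<^sup>2)
      = ((\<Sum>i\<in>I. \<Sum>j\<in>I. pair_weight m q i j) - 2 * \<epsilon> * M\<^sup>2) * W\<^sup>2"
    unfolding cI[symmetric]
    by (simp add: sum_distrib_right[symmetric] sum_subtractf power2_eq_square)
  also have "\<dots> \<ge> ((3 * real l - 5) / (3 * real l - 2) * M\<^sup>2 + M * q - (real q)\<^sup>2 - 2 * \<epsilon> * M\<^sup>2) * W\<^sup>2"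
    using sum_pair_weight_ge[OF l q] by (intro mult_right_mono) (auto simp: I_def M_def)
  finally show ?thesis by (simp add: S_def W_def)
qed

end

section \<open>Asymptotics\<close>

lemma (in antipodal_gadget) purple_sizes_lower_bound:
  assumes \<epsilon>: "\<epsilon> > 0" and l: "l \<ge> 2" and q: "q < m"
    and n: "(3 * l - 2) * m * card \<Omega> \<le> n"
    and t: "(real q + 1 + \<epsilon> * ((3 * real l - 2) * m)) * card \<Omega> + (real n - (3 * real l - 2) * m * card \<Omega>) < real t"
  defines "M \<equiv> (3 * real l - 2) * m"
  shows "\<exists>p \<in> purple_sizes n (2 * l) t.
    ((3 * real l - 5) / (3 * real l - 2) * M\<^sup>2 + M * q - (real q)\<^sup>2 - 2 * \<epsilon> * M\<^sup>2) * (card \<Omega>)\<^sup>2 \<le> 2 * real p"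
proof -
  define V where "V = indices l m \<times> \<Omega>"
  have cI: "real (card (indices l m)) = M"
    using l by (simp add: card_indices[OF l] M_def of_nat_diff)
  have cV: "card V = (3 * l - 2) * m * card \<Omega>"
    by (simp add: V_def card_cartesian_product card_indices[OF l])
  have "\<exists>p \<in> purple_sizes n (2 * l) t. card {(u, v) \<in> V \<times> V. u \<noteq> v \<and> adj m q u v \<and> \<not> near u v} \<le> 2 * p"
  proof (rule purple_sizes_of_relation)
    show "finite V" by (simp add: V_def finite_indices finite_\<Omega>)
    show "card V \<le> n" using n cV by simp
    show "2 \<le> 2 * l" using l by simp
    show "adj m q v u" if "adj m q u v" for u v using that by (rule adj_sym)
    show "near v u" if "near u v" for u v using that by (rule near_sym)
    show "card K < 2 * l" if "K \<subseteq> V" "\<And>u v. \<lbrakk>u \<in> K; v \<in> K; u \<noteq> v\<rbrakk> \<Longrightarrow> adj m q u v" for K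
      using card_clique_less[OF l q, of K] that by (simp add: V_def)
    show "card K + (n - card V) < t"
      if "K \<subseteq> V" "\<And>u v. \<lbrakk>u \<in> K; v \<in> K; u \<noteq> v\<rbrakk> \<Longrightarrow> \<not> (adj m q u v \<and> near u v)" for K
    proof -
      have "real (card K) \<le> (real q + 1 + \<epsilon> * M) * card \<Omega>"
        using card_independent_le[OF \<epsilon> q, of K l] that by (simp add: V_def cI)
      moreover have "real (n - card V) = real n - M * card \<Omega>"
        using n l by (simp add: cV M_def of_nat_diff)
      ultimately have "real (card K + (n - card V)) < real t" using t by (simp add: M_def)
      then show ?thesis by (simp only: of_nat_less_iff)
    qed
  qed
  then obtain p where p: "p \<in> purple_sizes n (2 * l) t"
    "card {(u, v) \<in> V \<times> V. u \<noteq> v \<and> adj m q u v \<and> \<not> near u v} \<le> 2 * p" by blast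
  then have "real (card {(u, v) \<in> V \<times> V. u \<noteq> v \<and> adj m q u v \<and> \<not> near u v}) \<le> 2 * real p"
    using of_nat_mono[OF p(2), where 'a = real] by (simp only: of_nat_mult of_nat_numeral)
  with card_purple_pairs_ge[OF \<epsilon> l q] show ?thesis
    unfolding V_def M_def using p(1) by (intro bexI[of _ p]) (rule order_trans)
qed

text \<open>The gadget depends only on \<open>\<epsilon>\<close> and \<open>c\<close>, so its size
  is constant as \<open>n\<close> grows; only \<open>m\<close> and \<open>q\<close> follow
  \<open>n\<close>, and fewer than \<open>D\<close> vertices remain uncovered.\<close>

lemma eventually_purple_size:
  fixes l :: nat and c \<epsilon> :: real
  assumes l: "l \<ge> 2" and c: "0 < c" "c < 1 / (3 * real l - 2)" and \<epsilon>: "\<epsilon> > 0"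
  shows "\<forall>\<^sub>F n in sequentially. \<exists>p \<in> purple_sizes n (2 * l) (nat \<lceil>c * real n\<rceil>).
    ((3 * real l - 5) / (3 * real l - 2) + c - c\<^sup>2 - \<epsilon>) * (real n)\<^sup>2 \<le> 2 * real p"
proof -
  \<comment> \<open>The loss \<open>5 * \<delta>\<close> consists of \<open>2 * \<delta>\<close>
    from replacing \<open>c\<close> by \<open>c'\<close>, \<open>2 * \<delta>\<close> from the
    purple count and \<open>\<delta>\<close> from rounding. The bounds \<open>1 / 16\<close> and
    \<open>c / 4\<close> keep \<open>A\<close> nonnegative and \<open>c'\<close> positive.\<close>
  define \<delta> where "\<delta> = min (min (\<epsilon> / 5) (1 / 16)) (c / 4)"
  have \<delta>: "\<delta> > 0" "5 * \<delta> \<le> \<epsilon>" "\<delta> \<le> 1 / 16" "4 * \<delta> \<le> c" using \<epsilon> c by (auto simp: \<delta>_def)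
  obtain \<Omega> :: "(nat \<times> nat) set set" and N H where "antipodal_gadget \<delta> \<Omega> N H"
    using antipodal_gadget_exists[OF \<delta>(1)] by blast
  then interpret antipodal_gadget \<delta> \<Omega> N H .
  define a :: real where "a = 3 * real l - 2"
  have a: "a \<ge> 4" using l by (simp add: a_def)
  have ca: "c * a < 1" using c(2)[folded a_def] a by (simp add: field_simps)
  have c4: "c < 1 / 4"
  proof -
    have "c * 4 \<le> c * a" using a c by (intro mult_left_mono) auto
    then show ?thesis using ca by simp
  qed
  define W :: real where "W = card \<Omega>"
  have W: "W \<ge> 1" using finite_\<Omega> \<Omega>_nonempty by (simp add: W_def Suc_le_eq card_gt_0_iff)
  define D where "D = (3 * l - 2) * card \<Omega>"
  have D: "real D = a * W" using l by (simp add: D_def a_def W_def of_nat_diff)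
  then have D0: "D > 0" using a W by (metis less_le_trans mult_pos_pos of_nat_0_less_iff zero_less_numeral zero_less_one)
  define v where "v = (3 * real l - 5) / a"
  have v: "1 / 4 \<le> v" "v \<le> 1" using l a by (simp_all add: v_def a_def field_simps)
  \<comment> \<open>Of the margin \<open>2 * \<delta>\<close>, one half pays for the thinly occupied
    positions in an independent set, the other for the uncovered vertices and the off-by-one in
    \<open>q + 1\<close>.\<close>
  define c' where "c' = c - 2 * \<delta>"
  have c': "c' > 0" "c' < c" using \<delta> by (auto simp: c'_def)
  define A where "A = v + c - c\<^sup>2 - 4 * \<delta>"
  have "c * c \<le> c * 1" using c4 c by (intro mult_left_mono) auto
  then have c2: "0 \<le> c - c\<^sup>2" "c - c\<^sup>2 \<le> 1" using c c4 zero_le_power2[of c] unfolding power2_eq_square by linarith+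
  have A: "0 \<le> A" "A \<le> 2" using v c2 \<delta> by (auto simp: A_def)
  define n0 where "n0 = nat \<lceil>(4 * D + W) / \<delta>\<rceil> + D"
  show ?thesis
    unfolding eventually_sequentially
  proof (intro exI[of _ n0] allI impI)
    fix n assume n: "n0 \<le> n"
    have nD: "D \<le> n" using n by (simp add: n0_def)
    have n_big: "4 * D + W \<le> \<delta> * n"
    proof -
      have "(4 * D + W) / \<delta> \<le> n" using n by (simp add: n0_def) linarith
      then show ?thesis using \<delta>(1) by (simp add: field_simps)
    qed
    define m where "m = n div D"
    have m: "m > 0" using nD D0 by (simp add: m_def div_greater_zero_iff)
    define M where "M = a * m"
    have M: "M \<ge> 4" using a m mult_mono[of 4 a 1 "real m"] by (simp add: M_def)
    have MW: "M * W = real (D * m)" by (simp add: M_def D)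
    have nDm: "D * m \<le> n" "n < D * m + D"
    proof -
      have "D * m + n mod D = n" by (simp add: m_def)
      moreover have "n mod D < D" using D0 by simp
      ultimately show "D * m \<le> n" "n < D * m + D" by linarith+
    qed
    have "real (D * m) \<le> real n" by (rule of_nat_mono[OF nDm(1)])
    moreover have "real n \<le> real (D * m + D)" by (rule of_nat_mono[OF less_imp_le[OF nDm(2)]])
    ultimately have MWn: "M * W \<le> n" "real n - D \<le> M * W" unfolding MW of_nat_add by linarith+
    define q where "q = nat \<lfloor>c' * M\<rfloor>"
    have qM: "real q \<le> c' * M" "c' * M - 1 \<le> q" using c' M by (simp_all add: q_def)
    \<comment> \<open>This is where the upper bound on \<open>c\<close> enters:
      \<open>c * M < m\<close>.\<close>
    have q: "q < m"
    proof -
      have "c' * M < c * M" using c' M by simp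
      also have "\<dots> = (c * a) * m" by (simp add: M_def)
      also have "\<dots> < 1 * real m" using ca m by (intro mult_strict_right_mono) auto
      finally show ?thesis using qM by linarith
    qed
    have "\<exists>p \<in> purple_sizes n (2 * l) (nat \<lceil>c * real n\<rceil>).
      ((3 * real l - 5) / (3 * real l - 2) * ((3 * real l - 2) * m)\<^sup>2 + (3 * real l - 2) * m * q - (real q)\<^sup>2
        - 2 * \<delta> * ((3 * real l - 2) * m)\<^sup>2) * (card \<Omega>)\<^sup>2 \<le> 2 * real p"
    proof (rule purple_sizes_lower_bound[OF \<delta>(1) l q])
      show "(3 * l - 2) * m * card \<Omega> \<le> n" using nDm by (simp add: D_def mult_ac)
      have "(real q + 1 + \<delta> * M) * W \<le> (c' * M + 1 + \<delta> * M) * W"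
        using qM W by (intro mult_right_mono) auto
      also have "\<dots> = (c' + \<delta>) * (M * W) + W" by (simp add: algebra_simps)
      also have "\<dots> \<le> (c' + \<delta>) * n + W" using MWn c' \<delta> by (intro add_mono mult_left_mono) auto
      also have "\<dots> = c * n - \<delta> * n + W" by (simp add: c'_def algebra_simps)
      finally have "(real q + 1 + \<delta> * M) * W + (n - M * W) \<le> c * n - \<delta> * n + W + D" using MWn by linarith
      also have "\<dots> < c * n" using n_big D0 by simp
      also have "\<dots> \<le> nat \<lceil>c * n\<rceil>" by linarith
      finally show "(real q + 1 + \<delta> * ((3 * real l - 2) * m)) * card \<Omega> + (real n - (3 * real l - 2) * m * card \<Omega>)
          < real (nat \<lceil>c * real n\<rceil>)"
        by (simp add: M_def a_def W_def)
    qed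
    then obtain p where p: "p \<in> purple_sizes n (2 * l) (nat \<lceil>c * real n\<rceil>)"
      "(v * M\<^sup>2 + M * q - (real q)\<^sup>2 - 2 * \<delta> * M\<^sup>2) * W\<^sup>2 \<le> 2 * real p"
      by (auto simp: M_def a_def v_def W_def)
    have "(A - \<delta>) * (real n)\<^sup>2 \<le> 2 * real p"
    proof -
      have "(c' * M - 1) * (M - c' * M) \<le> q * (M - q)"
        using qM c' c4 M by (intro mult_mono) (auto simp: mult_le_cancel_right1)
      moreover have "q * (M - q) = M * q - (real q)\<^sup>2" by (simp add: power2_eq_square algebra_simps)
      moreover have "(c' * M - 1) * (M - c' * M) = (c' - c'\<^sup>2) * M\<^sup>2 - M + c' * M"
        by (simp add: power2_eq_square algebra_simps)
      moreover have "(c - c\<^sup>2 - 2 * \<delta>) * M\<^sup>2 \<le> (c' - c'\<^sup>2) * M\<^sup>2"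
      proof (rule mult_right_mono)
        have "c'\<^sup>2 \<le> c\<^sup>2" using c' by (intro power_mono) auto
        then show "c - c\<^sup>2 - 2 * \<delta> \<le> c' - c'\<^sup>2" by (simp add: c'_def)
      qed simp
      moreover have "c' * M \<ge> 0" using c' M by simp
      ultimately have "(c - c\<^sup>2 - 2 * \<delta>) * M\<^sup>2 - M \<le> M * q - (real q)\<^sup>2" by linarith
      then have "A * M\<^sup>2 - M \<le> v * M\<^sup>2 + M * q - (real q)\<^sup>2 - 2 * \<delta> * M\<^sup>2"
        by (simp add: A_def algebra_simps)
      then have "(A * M\<^sup>2 - M) * W\<^sup>2 \<le> (v * M\<^sup>2 + M * q - (real q)\<^sup>2 - 2 * \<delta> * M\<^sup>2) * W\<^sup>2"
        by (intro mult_right_mono) auto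
      then have 1: "A * (M * W)\<^sup>2 - W * (M * W) \<le> 2 * real p"
        using p(2) by (simp add: power2_eq_square algebra_simps)
      have "(real n - D)\<^sup>2 \<le> (M * W)\<^sup>2"
        using MWn nD by (intro power_mono) auto
      moreover have "(real n)\<^sup>2 - 2 * real D * real n \<le> (real n - D)\<^sup>2" by (simp add: power2_diff)
      ultimately have "(real n)\<^sup>2 - 2 * real D * real n \<le> (M * W)\<^sup>2" by linarith
      then have "A * ((real n)\<^sup>2 - 2 * real D * real n) \<le> A * (M * W)\<^sup>2" using A by (intro mult_left_mono) auto
      moreover have "A * (2 * real D * real n) \<le> 2 * (2 * real D * real n)" using A by (intro mult_right_mono) auto
      moreover have "W * (M * W) \<le> W * n" using MWn W by (intro mult_left_mono) auto
      ultimately have "A * (real n)\<^sup>2 - (4 * D + W) * n \<le> 2 * real p"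
        using 1 by (simp add: algebra_simps)
      moreover have "(4 * D + W) * n \<le> \<delta> * n * n" using n_big by (intro mult_right_mono) auto
      ultimately show ?thesis by (simp add: power2_eq_square algebra_simps)
    qed
    moreover have "(v + c - c\<^sup>2 - \<epsilon>) * (real n)\<^sup>2 \<le> (A - \<delta>) * (real n)\<^sup>2"
      using \<delta>(2) by (intro mult_right_mono) (auto simp: A_def)
    ultimately show "\<exists>p \<in> purple_sizes n (2 * l) (nat \<lceil>c * real n\<rceil>).
      ((3 * real l - 5) / (3 * real l - 2) + c - c\<^sup>2 - \<epsilon>) * (real n)\<^sup>2 \<le> 2 * real p"
      using p(1) unfolding v_def a_def by (intro bexI[of _ p]) linarith+
  qed
qed

theorem theorem5p3:
  fixes l :: nat and c :: real
  assumes "l \<ge> 2" and "0 < c" and "c < 1 / (3 * real l - 2)"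
  shows "\<exists>h :: nat \<Rightarrow> real. h \<in> o(\<lambda>_. 1) \<and>
           (\<forall>\<^sub>F n in sequentially.
              n < ramsey_number (2 * l) (nat \<lceil>c * real n\<rceil>) \<and>
              real (g n (real (2 * l)) (c * real n)) \<ge>
                1 / 2 * ((3 * real l - 5) / (3 * real l - 2) + c - c\<^sup>2 - h n) * (real n)\<^sup>2)"
proof -
  define v where "v = (3 * real l - 5) / (3 * real l - 2) + c - c\<^sup>2"
  define \<gamma> where "\<gamma> n = real (g n (real (2 * l)) (c * real n))" for n
  \<comment> \<open>For \<open>n > 0\<close> this is the least nonnegative error for which the
    inequality holds, so the asymptotic content lies in showing that it tends to 0.\<close>
  define h where "h n = max 0 (v - 2 * \<gamma> n / (real n)\<^sup>2)" for n
  note ev = eventually_purple_size[OF assms]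
  have g_ge: "real p \<le> \<gamma> n" if "p \<in> purple_sizes n (2 * l) (nat \<lceil>c * real n\<rceil>)" for p n
  proof -
    have "nat \<lceil>real (2 * l)\<rceil> = 2 * l" by (simp only: ceiling_of_nat nat_int)
    then show ?thesis
      using that finite_purple_sizes by (simp only: \<gamma>_def g_def g_nat_def of_nat_le_iff Max_ge)
  qed
  have "h \<in> o(\<lambda>_. 1)"
  proof (rule landau_o.smallI)
    fix e :: real assume e: "e > 0"
    show "\<forall>\<^sub>F n in sequentially. norm (h n) \<le> e * norm (1 :: real)"
      using ev[OF e] eventually_gt_at_top[of 0]
    proof eventually_elim
      case (elim n)
      then obtain p where p: "p \<in> purple_sizes n (2 * l) (nat \<lceil>c * real n\<rceil>)"
        "(v - e) * (real n)\<^sup>2 \<le> 2 * real p" unfolding v_def by blast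
      then have "(v - e) * (real n)\<^sup>2 \<le> 2 * \<gamma> n" using g_ge[OF p(1)] by linarith
      then have "v - e \<le> 2 * \<gamma> n / (real n)\<^sup>2" using elim by (simp add: field_simps)
      then show ?case using e by (simp add: h_def)
    qed
  qed
  moreover have "\<forall>\<^sub>F n in sequentially. n < ramsey_number (2 * l) (nat \<lceil>c * real n\<rceil>) \<and>
      1 / 2 * (v - h n) * (real n)\<^sup>2 \<le> \<gamma> n"
    \<comment> \<open>The accuracy 1 is arbitrary: the bound serves here only to make
      \<open>purple_sizes\<close> nonempty, that is, to put \<open>n\<close> below the Ramsey
      number.\<close>
    using ev[of 1, OF zero_less_one] eventually_gt_at_top[of 0]
  proof eventually_elim
    case (elim n)
    then have "purple_sizes n (2 * l) (nat \<lceil>c * real n\<rceil>) \<noteq> {}" by blast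
    moreover have "v - h n \<le> 2 * \<gamma> n / (real n)\<^sup>2" by (simp add: h_def)
    then have "(v - h n) * (real n)\<^sup>2 \<le> 2 * \<gamma> n" using elim(2) by (simp add: field_simps)
    ultimately show ?case by (simp add: purple_sizes_nonempty_iff)
  qed
  ultimately show ?thesis unfolding v_def \<gamma>_def by blast
qed

end
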